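(* Let $d$ be prime and $N\ge1$. Let $\pi_0$ be the unique invariant probability measure of the reference kernel $P_0$ (injection strength $\theta_M=0$) on $\mathsf X=\mathbb{CP}^{d^N-1}$, and let $S_{\mathrm{stab}}^{(d,N)}\subset\mathsf X$ be the set of $N$-qudit stabilizer pure states. Then $$\pi_0\bigl(S_{\mathrm{stab}}^{(d,N)}\bigr)=1.$$
   Context: Let $d$ be prime, $N\ge1$, $D=d^N$, $\mathcal H=(\mathbb C^d)^{\otimes N}$, $\omega=e^{2\pi i/d}$, computational basis $|m\rangle$, $m\in\mathbb F_d$. $\mathsf X=\mathbb{CP}^{D-1}$ is the space of rays in $\mathcal H$. On one qudit, $X|m\rangle=|m+1\rangle$, $Z|m\rangle=\omega^m|m\rangle$. The projective Pauli group is the group of classes in $PU(D)$ of $\bigotimes_jZ^{p_j}X^{q_j}$ ($\cong\mathbb F_d^{2N}$); the projective Clifford group $\mathcal C_{d,N}$ is its normalizer in $PU(D)$, a finite group whose elements are identified with unitary representatives. A stabilizer pure state is a ray that is the common eigenray determined by a maximal isotropic (order $d^N$, commuting) subgroup of Paulis together with a character; equivalently an element of the $\mathcal C_{d,N}$-orbit of $|0\rangle^{\otimes N}$. With $\Pi_m=|m\rangle\langle m|\otimes I^{\otimes(N-1)}$, the reference kernel is $$P_0(\psi,\cdot)=\frac1{|\mathcal C_{d,N}|}\sum_{U\in\mathcal C_{d,N}}\ \sum_{m\in\mathbb F_d:\ \Pi_mU\psi\ne0}\|\Pi_mU\psi\|^2\,\delta_{[U^\dagger\Pi_mU\psi]}$$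 (for a unit representative of $\psi$). It is known to have a unique invariant probability measure $\pi_0$. *)

theory Defs
  imports
    "HOL-Probability.Probability"
    "HOL-Algebra.Group_Action"
    "Berlekamp_Zassenhaus.Finite_Field"
begin

text \<open>
  Conventions. \<open>'p\<close> ranges over the types of prime cardinality, so that \<open>'p mod_ring\<close> is the
  field with \<open>d = CARD('p)\<close> elements; \<open>'n\<close> is a finite nonempty type labelling the
  \<open>N = CARD('n)\<close> qudits. The computational basis of the \<open>N\<close>-fold tensor power of
  \<open>\<complex>\<^sup>d\<close> is indexed by the strings \<open>'n \<Rightarrow> 'p mod_ring\<close>, so the Hilbert space is
  \<open>complex ^ ('n \<Rightarrow> 'p mod_ring)\<close>, whose library norm is the Hilbert space norm.
\<close>

type_synonym 'i op = "complex ^ 'i ^ 'i"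

definition adj :: "'i::finite op \<Rightarrow> 'i op" where
  "adj A = (\<chi> i j. cnj (A $ j $ i))"

definition unitary :: "'i::finite op \<Rightarrow> bool" where
  "unitary U \<longleftrightarrow> U ** adj U = mat 1 \<and> adj U ** U = mat 1"


subsection \<open>Projective space\<close>

text \<open>A ray is a one-dimensional complex subspace (\<open>vec.span\<close> is the span over the
  field of scalars, here the complex numbers).\<close>

typedef ('i::finite) cproj = "{vec.span {\<psi>} | \<psi> :: complex ^ 'i. \<psi> \<noteq> 0}"
proof -
  have "(\<chi> i. 1) \<noteq> (0 :: complex ^ 'i)"
    by (simp add: vec_eq_iff)
  then show ?thesis by blast
qed

text \<open>Only meaningful for nonzero vectors.\<close>

definition ray :: "complex ^ 'i \<Rightarrow> ('i::finite) cproj" where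
  "ray \<psi> = Abs_cproj (vec.span {\<psi>})"

text \<open>The quotient topology; \<open>borel\<close> below refers to it.\<close>

instantiation cproj :: (finite) topological_space
begin

definition open_cproj :: "'a cproj set \<Rightarrow> bool" where
  "open_cproj V \<longleftrightarrow> open {\<psi> :: complex ^ 'a. \<psi> \<noteq> 0 \<and> ray \<psi> \<in> V}"

instance
proof
  have "{\<psi> :: complex ^ 'a. \<psi> \<noteq> 0 \<and> ray \<psi> \<in> UNIV} = - {0}" by auto
  then show "open (UNIV :: 'a cproj set)"
    unfolding open_cproj_def by (metis open_Compl closed_singleton)
next
  fix S T :: "'a cproj set"
  assume ST: "open S" "open T"
  have eq: "{\<psi> :: complex ^ 'a. \<psi> \<noteq> 0 \<and> ray \<psi> \<in> S \<inter> T} =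
      {\<psi>. \<psi> \<noteq> 0 \<and> ray \<psi> \<in> S} \<inter> {\<psi>. \<psi> \<noteq> 0 \<and> ray \<psi> \<in> T}" by blast
  show "open (S \<inter> T)"
    unfolding open_cproj_def eq using ST unfolding open_cproj_def by (rule open_Int)
next
  fix K :: "'a cproj set set"
  assume K: "\<forall>S\<in>K. open S"
  have eq: "{\<psi> :: complex ^ 'a. \<psi> \<noteq> 0 \<and> ray \<psi> \<in> \<Union>K} =
      (\<Union>S\<in>K. {\<psi>. \<psi> \<noteq> 0 \<and> ray \<psi> \<in> S})" by blast
  show "open (\<Union>K)"
    unfolding open_cproj_def eq using K unfolding open_cproj_def by (rule open_UN)
qed

end


subsection \<open>The projective unitary, Pauli and Clifford groups\<close>

definition unitary_group :: "('i::finite op) monoid" where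
  "unitary_group = \<lparr>carrier = {U. unitary U}, mult = (**), one = mat 1\<rparr>"

definition phases :: "('i::finite op) set" where
  "phases = {mat c | c. cmod c = 1}"

text \<open>Elements of \<open>PU\<close> are cosets, i.e. sets of unitary matrices differing by a phase.\<close>

definition PU :: "('i::finite op) set monoid" where
  "PU = unitary_group Mod phases"

text \<open>The canonical representative in \<open>{0..<d}\<close> of an element of the prime field.\<close>

definition fval :: "'p::prime_card mod_ring \<Rightarrow> nat" where
  "fval a = nat (to_int_mod_ring a)"

definition omega :: "'p::prime_card itself \<Rightarrow> complex" where
  "omega _ = exp (2 * of_real pi * \<i> / of_nat CARD('p))"

definition Xop :: "('p::prime_card mod_ring) op" where
  "Xop = (\<chi> a b. if a = b + 1 then 1 else 0)"

definition Zop :: "('p::prime_card mod_ring) op" where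
  "Zop = (\<chi> a b. if a = b then omega TYPE('p) ^ fval a else 0)"

text \<open>Power with respect to the matrix product (\<open>(^)\<close> on vectors would be componentwise).\<close>

definition matpow :: "'i::finite op \<Rightarrow> nat \<Rightarrow> 'i op" where
  "matpow A k = (((**) A) ^^ k) (mat 1)"

definition tensor :: "('n::finite \<Rightarrow> ('q::finite) op) \<Rightarrow> ('n \<Rightarrow> 'q) op" where
  "tensor A = (\<chi> s t. \<Prod>k\<in>UNIV. A k $ s k $ t k)"

definition pauli_string ::
  "('n::finite \<Rightarrow> 'p::prime_card mod_ring) \<Rightarrow> ('n \<Rightarrow> 'p mod_ring) \<Rightarrow> ('n \<Rightarrow> 'p mod_ring) op" where
  "pauli_string p q = tensor (\<lambda>j. matpow Zop (fval (p j)) ** matpow Xop (fval (q j)))"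

definition pauli_group :: "('n::finite \<Rightarrow> 'p::prime_card mod_ring) op set set" where
  "pauli_group = {phases #>\<^bsub>unitary_group\<^esub> pauli_string p q | p q. True}"

definition clifford_group :: "('n::finite \<Rightarrow> 'p::prime_card mod_ring) op set set" where
  "clifford_group = normalizer PU pauli_group"


subsection \<open>Stabilizer states\<close>

text \<open>\<open>\<L>\<close> is a subgroup of the projective Pauli group, of order \<open>d ^ N\<close>, whose
  representatives commute as unitaries. Its preimage \<open>\<Union>\<L>\<close> in the unitary group is then an
  honest abelian group, containing the phases, and \<open>\<kappa>\<close> is a character of it.\<close>

definition maximal_isotropic :: "('n::finite \<Rightarrow> 'p::prime_card mod_ring) op set set \<Rightarrow> bool" where
  "maximal_isotropic \<L> \<longleftrightarrow>
     subgroup \<L> PU \<and> \<L> \<subseteq> pauli_group \<and> card \<L> = CARD('p) ^ CARD('n) \<and>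
     (\<forall>A\<in>\<Union>\<L>. \<forall>B\<in>\<Union>\<L>. A ** B = B ** A)"

text \<open>A stabilizer state is a ray that is exactly the joint eigenspace of such a group for such a
  character.\<close>

definition stabilizer_states :: "('n::finite \<Rightarrow> 'p::prime_card mod_ring) cproj set" where
  "stabilizer_states = {x. \<exists>\<L> \<kappa>. maximal_isotropic \<L> \<and>
     (\<forall>A\<in>\<Union>\<L>. \<forall>B\<in>\<Union>\<L>. \<kappa> (A ** B) = \<kappa> A * \<kappa> B) \<and>
     Rep_cproj x = {\<psi>. \<forall>A\<in>\<Union>\<L>. A *v \<psi> = \<kappa> A *s \<psi>}}"


subsection \<open>The reference kernel\<close>

text \<open>\<open>site_proj j0 m\<close> is the projection onto \<open>|m>\<close> at the qudit \<open>j0\<close>, tensored with the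
  identity on the others; \<open>j0\<close> is the label of the first tensor factor.\<close>

definition site_proj :: "'n::finite \<Rightarrow> 'p::prime_card mod_ring \<Rightarrow> ('n \<Rightarrow> 'p mod_ring) op" where
  "site_proj j0 m =
     tensor (\<lambda>k. if k = j0 then (\<chi> a b. if a = m \<and> b = m then 1 else 0) else mat 1)"

definition unit_rep :: "('i::finite) cproj \<Rightarrow> complex ^ 'i" where
  "unit_rep x = (SOME \<psi>. norm \<psi> = 1 \<and> ray \<psi> = x)"

text \<open>A unitary representative of a class in \<open>PU\<close>; the kernel does not depend on the choice of it,
  nor on that of the unit vector.\<close>

definition unitary_rep :: "'i::finite op set \<Rightarrow> 'i op" where
  "unitary_rep C = (SOME U. U \<in> C)"

text \<open>The value \<open>P\<^sub>0(x, A)\<close>; \<open>return borel y\<close> is the Dirac measure at \<open>y\<close>.\<close>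

definition ref_kernel_value ::
  "'n::finite \<Rightarrow> ('n \<Rightarrow> 'p::prime_card mod_ring) cproj \<Rightarrow> ('n \<Rightarrow> 'p mod_ring) cproj set \<Rightarrow> ennreal"
  where
  "ref_kernel_value j0 x A =
     (let \<psi> = unit_rep x in
      ennreal (1 / card (clifford_group :: ('n \<Rightarrow> 'p mod_ring) op set set)) *
      (\<Sum>C\<in>clifford_group. let U = unitary_rep C in
         \<Sum>m\<in>{m. site_proj j0 m *v (U *v \<psi>) \<noteq> 0}.
           ennreal ((norm (site_proj j0 m *v (U *v \<psi>)))\<^sup>2) *
           emeasure (return borel (ray (adj U *v (site_proj j0 m *v (U *v \<psi>))))) A))"

definition ref_kernel ::
  "'n::finite \<Rightarrow> ('n \<Rightarrow> 'p::prime_card mod_ring) cproj \<Rightarrow> ('n \<Rightarrow> 'p mod_ring) cproj measure" where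
  "ref_kernel j0 x = measure_of UNIV (sets borel) (ref_kernel_value j0 x)"

lemma emeasure_ref_kernel:
  fixes x :: "('n::finite \<Rightarrow> 'p::prime_card mod_ring) cproj"
  assumes A: "A \<in> sets borel"
  shows "emeasure (ref_kernel j0 x) A = ref_kernel_value j0 x A"
proof -
  let ?B = "sets (borel :: ('n \<Rightarrow> 'p mod_ring) cproj measure)"
  have "sigma_algebra UNIV ?B"
    using sets.sigma_algebra_axioms[of "borel :: ('n \<Rightarrow> 'p mod_ring) cproj measure"]
    unfolding space_borel .
  moreover have "positive ?B (ref_kernel_value j0 x)"
    unfolding positive_def ref_kernel_value_def Let_def by simp
  moreover have "countably_additive ?B (ref_kernel_value j0 x)"
    unfolding countably_additive_def ref_kernel_value_def Let_def
    by (intro allI impI)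
      (simp only: ennreal_suminf_cmult suminf_sum summableI suminf_emeasure sets_return)
  ultimately show ?thesis
    unfolding ref_kernel_def using A by (rule emeasure_measure_of_sigma)
qed

definition invariant_prob :: "('a \<Rightarrow> 'a measure) \<Rightarrow> ('a::topological_space) measure \<Rightarrow> bool" where
  "invariant_prob K \<pi> \<longleftrightarrow> prob_space \<pi> \<and> sets \<pi> = sets borel \<and>
     (\<forall>A\<in>sets borel. emeasure \<pi> A = (\<integral>\<^sup>+ x. emeasure (K x) A \<partial>\<pi>))"

end

theory Submission
  imports Defs "HOL-Library.Function_Algebras"
begin

text \<open>
  Attach to a ray \<open>\<psi>\<close> the set \<open>S \<psi>\<close> of phase space directions whose Weyl operators have \<open>\<psi>\<close> as an
  eigenvector. It is an isotropic subspace, so it has at most \<open>d ^ N\<close> elements, with equality exactly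
  for stabilizer states. A step of the chain measures a Weyl operator \<open>w\<close>, and the new ray has
  \<open>(S \<psi> \<inter> w\<^sup>\<bottom>) + \<langle>w\<rangle>\<close> among its directions, hence at least as many directions as \<open>\<psi>\<close>. Below
  \<open>d ^ N\<close> some \<open>w\<close> lies in the symplectic complement of \<open>S \<psi>\<close> but not in \<open>S \<psi>\<close>, and since the Clifford group is
  transitive on nonzero directions, this \<open>w\<close> is measured with positive probability; the number of
  directions then grows strictly. So an invariant probability cannot charge rays
  with fewer than \<open>d ^ N\<close> directions.
\<close>

section \<open>Matrices and Hermitian inner product\<close>

text \<open>A Clifford unitary \<open>U\<close> acts in one step only through the Weyl operator that
  it conjugates, up to phase, onto Z at site \<open>j0\<close>: the conjugated site projections are
  the spectral projections of that operator. If \<open>P\<close> and \<open>Q\<close> are the powers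
  of two noncommuting Weyl operators, with phases chosen so that the d-th power is 1, then the sum
  of \<open>P k ** Q (- k)\<close> over k is sqrt d times a Clifford unitary that intertwines them.
  Cardinalities replace dimensions: character sums give |S| |perp S| = d^(2N), which yields both the
  isotropic bound and the new direction. That d^N directions leave only a line of joint eigenvectors
  comes from irreducibility of the Weyl operators. The gain in a step must be uniform in the state
  for the integral argument. It is at least 1 over the order of the Clifford group, because for a
  suitable Clifford class every outcome raises the count. Invariance then rules out mass on each
  count below d^N in turn.\<close>

lemma mat_mult_nth: "(mat c ** A) $ i $ j = c * (A $ i $ j)"
  for A :: "'i::finite op"
  by (simp add: matrix_matrix_mult_def mat_def if_distrib[of "\<lambda>x. x * _"] cong: if_cong)

lemma mult_mat_nth: "(A ** mat c) $ i $ j = c * (A $ i $ j)"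
  for A :: "'i::finite op"
  by (simp add: matrix_matrix_mult_def mat_def if_distrib[of "\<lambda>x. _ * x"] cong: if_cong)

lemma mat_commute: "A ** mat c = mat c ** A"
  for A :: "'i::finite op"
  by (simp add: vec_eq_iff mat_mult_nth mult_mat_nth)

lemma mat_mult_mat: "mat a ** mat b = (mat (a * b) :: 'i::finite op)"
  by (simp add: vec_eq_iff mat_mult_nth) (simp add: mat_def)

lemma mat_mult_mat_assoc: "mat a ** (mat b ** A) = mat (a * b) ** (A :: 'i::finite op)"
  by (simp add: matrix_mul_assoc mat_mult_mat)

lemma mat_left_commute: "A ** (mat c ** B) = mat c ** (A ** B)"
  for A :: "'i::finite op"
  by (metis mat_commute matrix_mul_assoc)

lemma mat_mult_assoc: "mat c ** A ** B = mat c ** (A ** B)"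
  for A :: "'i::finite op"
  by (simp add: matrix_mul_assoc)

lemmas mat_simps = mat_mult_mat mat_mult_mat_assoc mat_mult_assoc

lemma mat_vec: "mat c *v \<psi> = c *s \<psi>"
  for \<psi> :: "complex ^ 'i::finite"
  by (simp add: vec_eq_iff matrix_vector_mult_def mat_def if_distrib[of "\<lambda>x. x * _"] cong: if_cong)

lemma matrix_vector_mult_smult: "A *v (c *s \<psi>) = c *s (A *v \<psi>)"
  for \<psi> :: "complex ^ 'i::finite"
  by (simp add: vec_eq_iff matrix_vector_mult_def sum_distrib_left mult.left_commute)

lemma matrix_mult_sum_left: "(\<Sum>k\<in>K. f k) ** A = (\<Sum>k\<in>K. f k ** A)"
  for A :: "'i::finite op"
  by (simp add: vec_eq_iff matrix_matrix_mult_def sum_distrib_right) (auto intro: sum.swap)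

lemma matrix_mult_sum_right: "A ** (\<Sum>k\<in>K. f k) = (\<Sum>k\<in>K. A ** f k)"
  for A :: "'i::finite op"
  by (simp add: vec_eq_iff matrix_matrix_mult_def sum_distrib_left) (auto intro: sum.swap)

lemma sum_matrix_smult: "(\<Sum>k\<in>K. mat (c k) ** A) = mat (\<Sum>k\<in>K. c k) ** A"
  for A :: "'i::finite op"
  by (simp add: vec_eq_iff mat_mult_nth sum_distrib_right)

lemma adj_nth [simp]: "adj A $ i $ j = cnj (A $ j $ i)"
  by (simp add: adj_def)

lemma adj_adj [simp]: "adj (adj A) = A"
  by (simp add: vec_eq_iff)

lemma adj_mult: "adj (A ** B) = adj B ** adj A"
  by (simp add: vec_eq_iff matrix_matrix_mult_def mult.commute)

lemma adj_mat [simp]: "adj (mat c) = mat (cnj c)"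
  by (simp add: vec_eq_iff mat_def)

lemma adj_sum: "adj (\<Sum>k\<in>K. f k) = (\<Sum>k\<in>K. adj (f k))"
  by (simp add: vec_eq_iff)

lemma unitaryI: "U ** adj U = mat 1 \<Longrightarrow> unitary U"
  by (simp add: unitary_def matrix_left_right_inverse)

lemma unitaryD:
  assumes "unitary U"
  shows "U ** adj U = mat 1" "adj U ** U = mat 1"
  using assms by (simp_all add: unitary_def)

lemma unitary_cancel:
  assumes "unitary U"
  shows "U ** (adj U ** A) = A" "adj U ** (U ** A) = A"
  using unitaryD[OF assms] by (simp_all add: matrix_mul_assoc)

lemma unitary_adj: "unitary U \<Longrightarrow> unitary (adj U)"
  by (simp add: unitary_def)

lemma unitary_mult: "unitary U \<Longrightarrow> unitary V \<Longrightarrow> unitary (U ** V)"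
  by (rule unitaryI) (simp add: adj_mult matrix_mul_assoc[symmetric] unitary_cancel unitaryD)

lemma cnj_mult_self: "cmod c = 1 \<Longrightarrow> c * cnj c = 1" "cmod c = 1 \<Longrightarrow> cnj c * c = 1"
  by (simp_all add: complex_norm_square[symmetric] mult.commute[of "cnj c"])

lemma unitary_mat: "cmod c = 1 \<Longrightarrow> unitary (mat c)"
  by (rule unitaryI) (simp add: mat_mult_mat cnj_mult_self)

definition cip :: "complex ^ 'i::finite \<Rightarrow> complex ^ 'i \<Rightarrow> complex" where
  "cip \<phi> \<psi> = (\<Sum>i\<in>UNIV. cnj (\<phi> $ i) * \<psi> $ i)"

lemma cip_mult_left: "cip (A *v \<phi>) \<psi> = cip \<phi> (adj A *v \<psi>)"
  unfolding cip_def matrix_vector_mult_def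
  by (simp add: sum_distrib_left sum_distrib_right mult_ac) (rule sum.swap)

lemma cip_unitary: "unitary U \<Longrightarrow> cip (U *v \<phi>) (U *v \<psi>) = cip \<phi> \<psi>"
  by (simp add: cip_mult_left matrix_vector_mul_assoc unitaryD)

lemma cip_self: "cip \<psi> \<psi> = of_real ((norm \<psi>)\<^sup>2)"
proof -
  have "(norm \<psi>)\<^sup>2 = (\<Sum>i\<in>UNIV. (cmod (\<psi> $ i))\<^sup>2)"
    by (simp add: norm_vec_def L2_set_def sum_nonneg)
  then show ?thesis
    unfolding cip_def by (simp add: complex_norm_square mult.commute del: of_real_power)
qed

lemma norm_unitary: "unitary U \<Longrightarrow> norm (U *v \<psi>) = norm \<psi>"
  using cip_unitary[of U \<psi> \<psi>] unfolding cip_self by (simp del: of_real_power)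

lemma cip_smult [simp]: "cip (c *s \<phi>) \<psi> = cnj c * cip \<phi> \<psi>" "cip \<phi> (c *s \<psi>) = c * cip \<phi> \<psi>"
  by (simp_all add: cip_def sum_distrib_left mult_ac)

lemma cip_diff_right: "cip \<phi> (\<psi> - \<xi>) = cip \<phi> \<psi> - cip \<phi> \<xi>"
  by (simp add: cip_def sum_subtractf right_diff_distrib)

lemma norm_cvec_smult: "norm (c *s \<psi>) = cmod c * norm \<psi>"
  for \<psi> :: "complex ^ 'i::finite"
  by (simp add: norm_vec_def norm_mult L2_set_left_distrib L2_set_right_distrib)

lemma unitary_eigenvalue:
  assumes "unitary U" "U *v \<psi> = c *s \<psi>" "\<psi> \<noteq> 0"
  shows "cmod c = 1"
  using norm_unitary[OF assms(1), of \<psi>] assms(2,3) by (simp add: norm_cvec_smult)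

section \<open>Additive characters of the prime field\<close>

text \<open>The standard additive character of the prime field. With field elements as exponents,
  the bookkeeping of phases becomes arithmetic in \<open>'p mod_ring\<close>.\<close>

definition chi :: "'p::prime_card mod_ring \<Rightarrow> complex" where
  "chi a = omega TYPE('p) ^ fval a"

lemma of_nat_fval [simp]: "of_nat (fval a) = (a :: 'p::prime_card mod_ring)"
  unfolding fval_def of_nat_of_int_mod_ring o_def
  by (subst nat_0_le) (transfer, auto)+

lemma fval_less: "fval (a :: 'p::prime_card mod_ring) < CARD('p)"
  unfolding fval_def by transfer auto

lemma fval_of_nat: "fval (of_nat n :: 'p::prime_card mod_ring) = n mod CARD('p)"
  unfolding fval_def by transfer (simp add: zmod_int[symmetric])

lemma fval_0 [simp]: "fval (0 :: 'p::prime_card mod_ring) = 0"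
  using fval_of_nat[of 0] by simp

lemma omega_powers: "omega TYPE('p) ^ n = exp (2 * of_real pi * \<i> * of_nat n / of_nat CARD('p::prime_card))"
  unfolding omega_def exp_of_nat_mult[symmetric] by (simp add: field_simps)

lemma omega_power_card [simp]: "omega TYPE('p) ^ CARD('p::prime_card) = 1"
  unfolding omega_powers by simp

lemma omega_power_mod: "omega TYPE('p) ^ (n mod CARD('p)) = omega TYPE('p::prime_card) ^ n"
proof -
  have "omega TYPE('p) ^ n = omega TYPE('p) ^ (n mod CARD('p) + CARD('p) * (n div CARD('p)))"
    by simp
  also have "\<dots> = omega TYPE('p) ^ (n mod CARD('p))"
    by (simp only: power_add power_mult omega_power_card power_one mult_1_right)
  finally show ?thesis ..
qed

lemma chi_of_nat: "chi (of_nat n :: 'p::prime_card mod_ring) = omega TYPE('p) ^ n"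
  by (simp add: chi_def fval_of_nat omega_power_mod)

lemma chi_0 [simp]: "chi 0 = 1"
  by (simp add: chi_def)

lemma chi_add: "chi (a + b) = chi a * chi b"
  by (metis chi_of_nat of_nat_add of_nat_fval power_add)

lemma chi_mult_uminus: "chi a * chi (- a) = 1"
  using chi_add[of a "- a"] by simp

lemma chi_sum: "finite K \<Longrightarrow> chi (\<Sum>k\<in>K. f k) = (\<Prod>k\<in>K. chi (f k))"
  by (induction K rule: finite_induct) (simp_all add: chi_add)

lemma norm_chi [simp]: "cmod (chi a) = 1"
  by (simp add: chi_def norm_power omega_def norm_exp_eq_Re)

lemma chi_nonzero [simp]: "chi a \<noteq> 0"
  using norm_chi[of a] by force

lemma chi_eq_1_iff [simp]: "chi a = 1 \<longleftrightarrow> a = (0 :: 'p::prime_card mod_ring)"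
proof
  assume "chi a = 1"
  then have "exp (2 * of_real pi * \<i> * of_nat (fval a) / of_nat CARD('p)) = 1"
    by (simp add: chi_def omega_powers)
  then obtain n :: int where "2 * pi * fval a / CARD('p) = of_int (2 * n) * pi"
    by (auto simp: exp_eq_1)
  then have "real (fval a) = real_of_int (n * int CARD('p))"
    by (simp add: field_simps)
  then have "int (fval a) = n * int CARD('p)"
    by linarith
  then have "CARD('p) dvd fval a"
    by (metis dvd_triv_right int_dvd_int_iff)
  then have "fval a = 0"
    using fval_less[of a] by (auto dest: dvd_imp_le)
  then show "a = 0"
    by (metis of_nat_0 of_nat_fval)
qed simp

lemma chi_uminus: "chi (- a) = cnj (chi a)"
  using chi_mult_uminus[of a] cnj_mult_self(1)[OF norm_chi, of a] chi_nonzero[of a]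
  by (metis mult_left_cancel)

lemma chi_inject: "chi a = chi b \<longleftrightarrow> a = b"
proof
  assume "chi a = chi b"
  then have "chi (a - b) = 1"
    using chi_add[of "a - b" b] by simp
  then show "a = b" by simp
qed simp

text \<open>Shifting \<open>k\<close> by 1 multiplies the sum by \<open>chi c\<close>, which differs
  from 1 unless \<open>c = 0\<close>.\<close>

lemma sum_chi: "(\<Sum>k\<in>UNIV. chi (k * c)) = (if c = 0 then of_nat CARD('p) else 0)"
  for c :: "'p::prime_card mod_ring"
proof (cases "c = 0")
  case False
  let ?S = "\<Sum>k\<in>UNIV. chi (k * c)"
  have "?S = (\<Sum>k\<in>UNIV. chi ((k + 1) * c))"
    by (rule sum.reindex_bij_witness[of _ "\<lambda>k. k + 1" "\<lambda>k. k - 1"]) auto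
  also have "\<dots> = chi c * ?S"
    by (simp add: distrib_right chi_add sum_distrib_left mult.commute[of "chi c"])
  finally have "(chi c - 1) * ?S = 0"
    by (simp add: algebra_simps)
  with False show ?thesis by simp
qed simp

section \<open>Weyl operators\<close>

type_synonym ('n, 'p) phase_space = "('n \<Rightarrow> 'p mod_ring) \<times> ('n \<Rightarrow> 'p mod_ring)"

text \<open>The matrix of Z^p X^q for \<open>v = (p, q)\<close>, without the symmetrising phase
  \<open>chi (p * q / 2)\<close>, which would require 2 to be invertible.\<close>

definition weyl :: "('n::finite, 'p::prime_card) phase_space \<Rightarrow> ('n \<Rightarrow> 'p mod_ring) op" where
  "weyl v = (\<chi> s t. if s = t + snd v then chi (\<Sum>k\<in>UNIV. fst v k * s k) else 0)"

definition symp :: "('n::finite, 'p::prime_card) phase_space \<Rightarrow> ('n, 'p) phase_space \<Rightarrow> 'p mod_ring" where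
  "symp v w = (\<Sum>k\<in>UNIV. fst v k * snd w k - fst w k * snd v k)"

definition scal :: "'p::prime_card mod_ring \<Rightarrow> ('n, 'p) phase_space \<Rightarrow> ('n, 'p) phase_space" where
  "scal a v = (\<lambda>k. a * fst v k, \<lambda>k. a * snd v k)"

lemma weyl_nth: "weyl v $ s $ t = (if s = t + snd v then chi (\<Sum>k\<in>UNIV. fst v k * s k) else 0)"
  by (simp add: weyl_def)

lemma matpow_Suc: "matpow A (Suc n) = A ** matpow A n"
  by (simp add: matpow_def)

lemma matpow_0 [simp]: "matpow A 0 = mat 1"
  by (simp add: matpow_def)

section \<open>Identification of Pauli strings with Weyl operators\<close>

lemma Zop_nth: "Zop $ a $ b = (if a = b then chi a else 0)"
  by (simp add: Zop_def chi_def)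

lemma Xop_nth: "Xop $ a $ b = (if a = b + 1 then 1 else 0)"
  by (simp add: Xop_def)

lemma matpow_Zop: "matpow Zop n $ a $ b = (if a = b then chi (of_nat n * a) else 0)"
  for a b :: "'p::prime_card mod_ring"
proof (induction n arbitrary: a b)
  case 0
  then show ?case by (simp add: mat_def)
next
  case (Suc n)
  have "matpow Zop (Suc n) $ a $ b =
      (\<Sum>c\<in>UNIV. (if c = a then chi a * (if a = b then chi (of_nat n * a) else 0) else 0))"
    unfolding matpow_Suc matrix_matrix_mult_def vec_lambda_beta
    by (rule sum.cong) (auto simp: Suc Zop_nth)
  then show ?case
    by (simp add: distrib_right chi_add)
qed

lemma matpow_Xop: "matpow Xop n $ a $ b = (if a = b + of_nat n then 1 else 0)"
  for a b :: "'p::prime_card mod_ring"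
proof (induction n arbitrary: a b)
  case 0
  then show ?case by (simp add: mat_def)
next
  case (Suc n)
  have "matpow Xop (Suc n) $ a $ b =
      (\<Sum>c\<in>UNIV. (if c = a - 1 then (if a - 1 = b + of_nat n then 1 else 0) else 0))"
    unfolding matpow_Suc matrix_matrix_mult_def vec_lambda_beta
    by (rule sum.cong) (auto simp: Suc Xop_nth)
  also have "\<dots> = (if a = b + of_nat (Suc n) then 1 else 0)"
    by (auto simp: algebra_simps)
  finally show ?case .
qed

lemma matpow_Zop_Xop:
  "(matpow Zop (fval p) ** matpow Xop (fval q)) $ a $ b = (if a = b + q then chi (p * a) else 0)"
  for a b :: "'p::prime_card mod_ring"
proof -
  have "(matpow Zop (fval p) ** matpow Xop (fval q)) $ a $ b =
      (\<Sum>c\<in>UNIV. (if c = a then chi (p * a) * (if a = b + q then 1 else 0) else 0))"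
    unfolding matrix_matrix_mult_def vec_lambda_beta
    by (rule sum.cong) (auto simp: matpow_Zop matpow_Xop)
  then show ?thesis by simp
qed

lemma pauli_string_eq_weyl: "pauli_string p q = weyl (p, q)"
proof -
  have "(\<Prod>k\<in>UNIV. if s k = t k + q k then chi (p k * s k) else 0) =
      (if s = t + q then chi (\<Sum>k\<in>UNIV. p k * s k) else 0)"
    for s t :: "'a \<Rightarrow> 'b mod_ring"
  proof (cases "s = t + q")
    case False
    then obtain k where "s k \<noteq> t k + q k" by (auto simp: fun_eq_iff)
    then have "(\<Prod>k\<in>UNIV. if s k = t k + q k then chi (p k * s k) else 0) = 0"
      by (intro prod_zero) auto
    with False show ?thesis by simp
  qed (simp add: chi_sum)
  then show ?thesis
    unfolding pauli_string_def by (simp add: vec_eq_iff tensor_def weyl_nth matpow_Zop_Xop)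
qed

lemma weyl_mult_vec: "(weyl v *v \<psi>) $ s = chi (\<Sum>k\<in>UNIV. fst v k * s k) * \<psi> $ (s - snd v)"
proof -
  have "(weyl v *v \<psi>) $ s =
      (\<Sum>t\<in>UNIV. if t = s - snd v then chi (\<Sum>k\<in>UNIV. fst v k * s k) * \<psi> $ t else 0)"
    unfolding matrix_vector_mult_def vec_lambda_beta by (rule sum.cong) (auto simp: weyl_nth)
  then show ?thesis by simp
qed

lemma weyl_0 [simp]: "weyl 0 = mat 1"
  by (auto simp: vec_eq_iff weyl_nth mat_def)

text \<open>The phase is the cost of moving the X part of \<open>v\<close> to the right past the Z
  part of \<open>w\<close>. Comparing the action on vectors avoids matrix sums, since each Weyl
  operator is a shift followed by a diagonal phase.\<close>

lemma weyl_mult: "weyl v ** weyl w = mat (chi (- (\<Sum>k\<in>UNIV. fst w k * snd v k))) ** weyl (v + w)"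
proof -
  have "(weyl v *v (weyl w *v \<psi>)) $ s =
      (mat (chi (- (\<Sum>k\<in>UNIV. fst w k * snd v k))) *v (weyl (v + w) *v \<psi>)) $ s" for \<psi> s
  proof -
    have "(\<Sum>k\<in>UNIV. fst w k * (s - snd v) k) = - (\<Sum>k\<in>UNIV. fst w k * snd v k) + (\<Sum>k\<in>UNIV. fst w k * s k)"
      by (simp add: right_diff_distrib sum_subtractf)
    moreover have "(\<Sum>k\<in>UNIV. fst (v + w) k * s k) = (\<Sum>k\<in>UNIV. fst v k * s k) + (\<Sum>k\<in>UNIV. fst w k * s k)"
      by (simp add: distrib_right sum.distrib)
    moreover have "s - snd v - snd w = s - snd (v + w)"
      by (simp add: diff_diff_eq)
    ultimately show ?thesis
      by (simp only: weyl_mult_vec mat_vec vector_smult_component chi_add mult_ac)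
  qed
  then have "weyl v *v (weyl w *v \<psi>) =
      mat (chi (- (\<Sum>k\<in>UNIV. fst w k * snd v k))) *v (weyl (v + w) *v \<psi>)" for \<psi>
    by (simp only: vec_eq_iff) blast
  then show ?thesis
    by (simp add: matrix_eq matrix_vector_mul_assoc)
qed

lemma weyl_commute: "weyl v ** weyl w = mat (chi (symp v w)) ** (weyl w ** weyl v)"
  unfolding weyl_mult mat_simps chi_add[symmetric]
  by (simp add: symp_def sum_subtractf add.commute)

lemma adj_weyl: "adj (weyl v) = mat (chi (- (\<Sum>k\<in>UNIV. fst v k * snd v k))) ** weyl (- v)"
  by (auto simp: vec_eq_iff weyl_nth mat_mult_nth chi_uminus[symmetric] chi_add[symmetric]
      sum_negf sum.distrib distrib_left; rule arg_cong[of _ _ chi]; simp)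

lemma weyl_unitary: "unitary (weyl v)"
  by (rule unitaryI) (simp add: adj_weyl mat_left_commute[of "weyl _"] mat_simps weyl_mult chi_add[symmetric] sum_negf)

lemma weyl_ex_mult: "\<exists>c. cmod c = 1 \<and> weyl v ** weyl w = mat c ** weyl (v + w)"
  using norm_chi weyl_mult by blast

text \<open>The support of the matrix determines the X part and the phases along the support
  determine the Z part; the row index 0 fixes the scalar. Hence distinct labels give distinct
  classes modulo phases.\<close>

lemma weyl_inject:
  assumes "weyl v = mat c ** weyl w"
  shows "v = w"
proof -
  have *: "(if s = t + snd v then chi (\<Sum>k\<in>UNIV. fst v k * s k) else 0) =
      c * (if s = t + snd w then chi (\<Sum>k\<in>UNIV. fst w k * s k) else 0)" for s t
    using assms by (simp add: vec_eq_iff weyl_nth mat_mult_nth)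
  have q: "snd v = snd w"
    using *[of "snd v" 0] by (auto split: if_splits)
  have **: "chi (\<Sum>k\<in>UNIV. fst v k * s k) = c * chi (\<Sum>k\<in>UNIV. fst w k * s k)" for s
    using *[of s "s - snd v"] by (simp add: q)
  have "c = 1"
    using **[of 0] by simp
  moreover have "(\<Sum>k\<in>UNIV. f k * (if k = j then 1 else 0)) = f j" for f :: "'a \<Rightarrow> 'b mod_ring" and j
    by (simp add: if_distrib cong: if_cong)
  ultimately have "fst v j = fst w j" for j
    using **[of "\<lambda>k. if k = j then 1 else 0"] by (simp add: chi_inject)
  with q show ?thesis by (auto simp: prod_eq_iff)
qed

section \<open>The symplectic form on phase space\<close>

lemma symp_add_left: "symp (u + v) w = symp u w + symp v w"
  by (simp add: symp_def sum.distrib[symmetric] algebra_simps)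

lemma symp_diff_left: "symp (u - v) w = symp u w - symp v w"
  by (simp add: symp_def sum_subtractf[symmetric] algebra_simps)

lemma symp_swap: "symp v w = - symp w v"
  by (simp add: symp_def sum_negf[symmetric])

lemma symp_add_right: "symp w (u + v) = symp w u + symp w v"
  by (simp add: symp_def sum.distrib[symmetric] algebra_simps)

lemma symp_scal_left: "symp (scal a v) w = a * symp v w"
  by (simp add: symp_def scal_def sum_distrib_left algebra_simps)

lemma symp_scal_right: "symp v (scal a w) = a * symp v w"
  by (simp add: symp_def scal_def sum_distrib_left algebra_simps)

lemma symp_0 [simp]: "symp 0 v = 0" "symp v 0 = 0"
  by (simp_all add: symp_def)

lemma scal_add: "scal (a + b) v = scal a v + scal b v"
  by (simp add: scal_def prod_eq_iff fun_eq_iff distrib_right)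

lemma scal_0 [simp]: "scal 0 v = 0"
  by (simp add: scal_def prod_eq_iff fun_eq_iff)

lemma scal_1 [simp]: "scal 1 v = v"
  by (simp add: scal_def)

lemma symp_nondegenerate:
  assumes "v \<noteq> 0"
  obtains w where "symp w v \<noteq> 0"
proof -
  have *: "(\<Sum>k\<in>UNIV. (if k = j then 1 else 0) * f k) = f j" for f :: "'a \<Rightarrow> 'b mod_ring" and j
    by (simp add: if_distrib[of "\<lambda>x. x * _"] cong: if_cong)
  from assms consider j where "fst v j \<noteq> 0" | j where "snd v j \<noteq> 0"
    by (auto simp: prod_eq_iff fun_eq_iff)
  then show thesis
  proof cases
    case 1
    have "symp (0, \<lambda>k. if k = j then 1 else 0) v = - fst v j"
      unfolding symp_def sum_subtractf by (simp add: mult.commute[of "fst v _"] *)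
    with 1 show thesis by (intro that[of "(0, \<lambda>k. if k = j then 1 else 0)"]) simp
  next
    case 2
    have "symp (\<lambda>k. if k = j then 1 else 0, 0) v = snd v j"
      unfolding symp_def sum_subtractf by (simp add: *)
    with 2 show thesis by (intro that[of "(\<lambda>k. if k = j then 1 else 0, 0)"]) simp
  qed
qed

text \<open>Two hyperplanes never cover phase space, even over the field with two elements: if
  \<open>a\<close> avoids only the first and \<open>b\<close> only the second, then
  \<open>a + b\<close> avoids both.\<close>

lemma symp_common_nonorthogonal:
  assumes "v \<noteq> 0" "w \<noteq> 0"
  obtains u where "symp u v \<noteq> 0" "symp u w \<noteq> 0"
proof -
  obtain a where a: "symp a v \<noteq> 0" using symp_nondegenerate[OF assms(1)] .
  obtain b where b: "symp b w \<noteq> 0" using symp_nondegenerate[OF assms(2)] .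
  show thesis
  proof (cases "symp a w = 0")
    case aw: True
    show thesis
    proof (cases "symp b v = 0")
      case True
      with a b aw show thesis by (intro that[of "a + b"]) (simp_all add: symp_add_left)
    qed (use b that in blast)
  qed (use a that in blast)
qed

subsection \<open>Operators proportional to a Weyl operator\<close>

definition is_weyl :: "('n::finite \<Rightarrow> 'p::prime_card mod_ring) op \<Rightarrow> bool" where
  "is_weyl A \<longleftrightarrow> (\<exists>c v. cmod c = 1 \<and> A = mat c ** weyl v)"

lemma is_weylI: "cmod c = 1 \<Longrightarrow> is_weyl (mat c ** weyl v)"
  unfolding is_weyl_def by blast

lemma is_weyl_weyl: "is_weyl (weyl v)"
  using is_weylI[of 1 v] by simp

lemma is_weyl_smult: "is_weyl A \<Longrightarrow> cmod c = 1 \<Longrightarrow> is_weyl (mat c ** A)"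
  unfolding is_weyl_def by (metis mat_mult_mat_assoc mult_1 norm_mult)

lemma is_weyl_mult:
  assumes "is_weyl A" "is_weyl B"
  shows "is_weyl (A ** B)"
proof -
  from assms obtain a v b w where "cmod a = 1" "A = mat a ** weyl v" "cmod b = 1" "B = mat b ** weyl w"
    unfolding is_weyl_def by blast
  moreover obtain c where "cmod c = 1" "weyl v ** weyl w = mat c ** weyl (v + w)"
    using weyl_ex_mult by blast
  ultimately have "A ** B = mat (a * b * c) ** weyl (v + w)" "cmod (a * b * c) = 1"
    by (simp_all add: mat_left_commute[of "weyl _"] mat_simps norm_mult mult_ac)
  then show ?thesis
    unfolding is_weyl_def by blast
qed

section \<open>Clifford unitaries\<close>

text \<open>The normalizer asks that conjugation map the Pauli group onto itself. The clause for the
  inverse conjugation encodes surjectivity, so that no counting is involved.\<close>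

definition clifford_op :: "('n::finite \<Rightarrow> 'p::prime_card mod_ring) op \<Rightarrow> bool" where
  "clifford_op U \<longleftrightarrow> unitary U \<and>
     (\<forall>v. is_weyl (U ** weyl v ** adj U)) \<and> (\<forall>v. is_weyl (adj U ** weyl v ** U))"

lemma clifford_op_unitary: "clifford_op U \<Longrightarrow> unitary U"
  by (simp add: clifford_op_def)

lemma is_weyl_conj:
  assumes "\<forall>v. is_weyl (U ** weyl v ** adj U)" "is_weyl A"
  shows "is_weyl (U ** A ** adj U)"
proof -
  obtain c v where "cmod c = 1" "A = mat c ** weyl v"
    using assms(2) unfolding is_weyl_def by blast
  with assms(1) show ?thesis
    by (simp add: mat_left_commute[of U] mat_simps is_weyl_smult del: split_paired_All)
qed

lemma clifford_op_mult:
  assumes "clifford_op U" "clifford_op V"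
  shows "clifford_op (U ** V)"
proof -
  have "is_weyl (U ** (V ** weyl v ** adj V) ** adj U)" for v
    using assms unfolding clifford_op_def by (metis is_weyl_conj)
  moreover have "is_weyl (adj V ** (adj U ** weyl v ** U) ** adj (adj V))" for v
    using assms unfolding clifford_op_def by (metis adj_adj is_weyl_conj)
  ultimately show ?thesis
    using assms by (simp add: clifford_op_def unitary_mult adj_mult matrix_mul_assoc)
qed

text \<open>The phases of a Weyl operator can be normalised so that its powers form a representation of
  the additive group of the field.\<close>

definition weyl_rep ::
  "('p::prime_card mod_ring \<Rightarrow> ('n::finite \<Rightarrow> 'p mod_ring) op) \<Rightarrow> ('n, 'p) phase_space \<Rightarrow> bool" where
  "weyl_rep R v \<longleftrightarrow> (\<forall>a b. R (a + b) = R a ** R b) \<and> R 0 = mat 1 \<and>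
     (\<forall>a. \<exists>c. cmod c = 1 \<and> R a = mat c ** weyl (scal a v))"

lemma matpow_add: "matpow A (m + n) = matpow A m ** matpow A n"
  by (induction m) (simp_all add: matpow_Suc matrix_mul_assoc)

lemma matpow_weyl: "\<exists>c. cmod c = 1 \<and> matpow (weyl v) n = mat c ** weyl (scal (of_nat n) v)"
proof (induction n)
  case 0
  show ?case by (intro exI[of _ 1]) simp
next
  case (Suc n)
  then obtain c where c: "cmod c = 1" "matpow (weyl v) n = mat c ** weyl (scal (of_nat n) v)"
    by blast
  obtain e where e: "cmod e = 1"
      "weyl v ** weyl (scal (of_nat n) v) = mat e ** weyl (v + scal (of_nat n) v)"
    using weyl_ex_mult by blast
  have "matpow (weyl v) (Suc n) = mat (c * e) ** weyl (scal (of_nat (Suc n)) v)"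
    unfolding matpow_Suc c mat_left_commute[of "weyl v"] e
    by (simp add: mat_simps scal_add)
  with c e show ?case
    by (intro exI[of _ "c * e"]) (simp add: norm_mult)
qed

lemma unit_complex_root:
  assumes "cmod \<beta> = 1" "n > 0"
  obtains \<alpha> where "cmod \<alpha> = 1" "\<alpha> ^ n * \<beta> = 1"
proof -
  obtain t where t: "\<beta> = cis t"
    using assms(1) by (metis cis_conv_exp complex_norm_eq_1_exp)
  have "cis (- t / n) ^ n = cis (- t)"
    using assms(2) by (subst Complex.DeMoivre) simp
  then show thesis
    by (intro that[of "cis (- t / n)"]) (simp_all add: t cis_mult del: minus_divide_left)
qed

text \<open>The d-th power of \<open>weyl v\<close> is a scalar but need not be 1: for one qubit ZX
  squares to -1. A d-th root of the inverse scalar is absorbed into the operator.\<close>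

lemma weyl_rep_exists:
  fixes v :: "('n::finite, 'p::prime_card) phase_space"
  obtains R where "weyl_rep R v"
proof -
  let ?d = "CARD('p)"
  obtain \<beta> where \<beta>: "cmod \<beta> = 1" "matpow (weyl v) ?d = mat \<beta>"
    using matpow_weyl[of v ?d] by auto
  obtain \<alpha> where \<alpha>: "cmod \<alpha> = 1" "\<alpha> ^ ?d * \<beta> = 1"
    using unit_complex_root[OF \<beta>(1), of ?d] by auto
  define r where "r n = mat (\<alpha> ^ n) ** matpow (weyl v) n" for n
  have add: "r (m + n) = r m ** r n" for m n
    unfolding r_def by (simp add: matpow_add power_add mat_left_commute[of "matpow _ _"] mat_simps)
  have card: "r ?d = mat 1"
    by (simp add: r_def \<beta> mat_simps \<alpha>)
  have "r (?d * k) = mat 1" for k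
    by (induction k) (simp_all add: add card, simp add: r_def)
  \<comment> \<open>\<open>fval\<close> is additive only modulo d; periodicity makes the passage to
    field exponents consistent.\<close>
  then have md: "r (n mod ?d) = r n" for n
    using add[of "n mod ?d" "?d * (n div ?d)"] by simp
  have "r (fval (a + b)) = r (fval a) ** r (fval b)" for a b :: "'p mod_ring"
    using md[of "fval a + fval b"] fval_of_nat[of "fval a + fval b", where 'p = 'p] by (simp add: add)
  moreover have "r (fval 0) = mat 1" by (simp add: r_def)
  moreover have "\<exists>c. cmod c = 1 \<and> r (fval a) = mat c ** weyl (scal a v)" for a
  proof -
    obtain c where "cmod c = 1" "matpow (weyl v) (fval a) = mat c ** weyl (scal a v)"
      using matpow_weyl[of v "fval a"] by auto
    then show ?thesis
      by (intro exI[of _ "\<alpha> ^ fval a * c"]) (simp add: r_def mat_simps norm_mult norm_power \<alpha>)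
  qed
  ultimately show thesis
    by (intro that[of "\<lambda>a. r (fval a)"]) (simp add: weyl_rep_def)
qed

context
  fixes R :: "'p::prime_card mod_ring \<Rightarrow> ('n::finite \<Rightarrow> 'p mod_ring) op" and v
  assumes R: "weyl_rep R v"
begin

lemma weyl_rep_add: "R a ** R b = R (a + b)"
  using R by (simp add: weyl_rep_def)

lemma weyl_rep_add_assoc: "R a ** (R b ** A) = R (a + b) ** A"
  by (simp add: matrix_mul_assoc weyl_rep_add)

lemma weyl_rep_0: "R 0 = mat 1"
  using R by (simp add: weyl_rep_def)

lemma weyl_rep_weyl: "\<exists>c. cmod c = 1 \<and> R a = mat c ** weyl (scal a v)"
  using R by (simp add: weyl_rep_def)

lemma weyl_rep_is_weyl: "is_weyl (R a)"
  using weyl_rep_weyl is_weylI by metis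

lemma weyl_rep_unitary: "unitary (R a)"
  using weyl_rep_weyl[of a] by (auto intro!: unitary_mult unitary_mat weyl_unitary)

lemma weyl_rep_adj: "adj (R a) = R (- a)"
proof -
  have "adj (R a) ** (R a ** R (- a)) = R (- a)"
    by (rule unitary_cancel(2)[OF weyl_rep_unitary])
  then show ?thesis
    by (simp add: weyl_rep_add weyl_rep_0)
qed

lemma weyl_rep_commute: "weyl x ** R a = mat (chi (a * symp x v)) ** (R a ** weyl x)"
proof -
  obtain c where c: "R a = mat c ** weyl (scal a v)"
    using weyl_rep_weyl by blast
  show ?thesis
    unfolding c mat_left_commute[of "weyl x"] weyl_commute[of x] symp_scal_right
    by (simp add: mat_simps mult.commute)
qed

end

lemma weyl_rep_commute2:
  assumes "weyl_rep P v" "weyl_rep Q w"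
  shows "P a ** Q b = mat (chi (a * b * symp v w)) ** (Q b ** P a)"
proof -
  obtain c where c: "P a = mat c ** weyl (scal a v)"
    using weyl_rep_weyl[OF assms(1)] by blast
  show ?thesis
    unfolding c mat_left_commute[of "Q b"] mat_simps weyl_rep_commute[OF assms(2)] symp_scal_left
    by (simp add: mult_ac)
qed

text \<open>Averaging \<open>P k ** A ** Q (- k)\<close> over \<open>k\<close> produces intertwiners of \<open>P\<close> and \<open>Q\<close>; when
  \<open>P 1\<close> and \<open>Q 1\<close> do not commute, \<open>A = mat 1\<close> yields a unitary up to the factor \<open>sqrt d\<close>.\<close>

definition intertwiner :: "('p::prime_card mod_ring \<Rightarrow> ('n::finite \<Rightarrow> 'p mod_ring) op) \<Rightarrow>
    ('p mod_ring \<Rightarrow> ('n \<Rightarrow> 'p mod_ring) op) \<Rightarrow> ('n \<Rightarrow> 'p mod_ring) op" where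
  "intertwiner P Q = mat (of_real (1 / sqrt CARD('p))) ** (\<Sum>k\<in>UNIV. P k ** Q (- k))"

context
  fixes P Q :: "'p::prime_card mod_ring \<Rightarrow> ('n::finite \<Rightarrow> 'p mod_ring) op" and v w
  assumes P: "weyl_rep P v" and Q: "weyl_rep Q w"
begin

text \<open>A shift of the summation index by \<open>a\<close> carries the factor from the left end
  of each term to the right end.\<close>

lemma intertwiner_intertwines: "P a ** intertwiner P Q = intertwiner P Q ** Q a"
proof -
  have "P a ** (\<Sum>k\<in>UNIV. P k ** Q (- k)) = (\<Sum>k\<in>UNIV. P (a + k) ** Q (- k))"
    by (simp add: matrix_mult_sum_right weyl_rep_add_assoc[OF P])
  also have "\<dots> = (\<Sum>k\<in>UNIV. P k ** Q (- k + a))"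
    by (rule sum.reindex_bij_witness[of _ "\<lambda>k. k - a" "\<lambda>k. a + k"]) auto
  also have "\<dots> = (\<Sum>k\<in>UNIV. P k ** Q (- k)) ** Q a"
    by (simp add: matrix_mult_sum_left weyl_rep_add[OF Q] matrix_mul_assoc[symmetric])
  finally show ?thesis
    unfolding intertwiner_def mat_left_commute[of "P a"] by (simp add: mat_simps)
qed

text \<open>The adjoint swaps the roles of the two representations, so a result about conjugation by
  an intertwiner also covers the inverse conjugation.\<close>

lemma adj_intertwiner: "adj (intertwiner P Q) = intertwiner Q P"
  unfolding intertwiner_def
  by (simp add: adj_mult adj_sum weyl_rep_adj[OF P] weyl_rep_adj[OF Q] mat_commute)

text \<open>In the double sum \<open>P k\<close> is moved to the right past \<open>Q s\<close>,
  which leaves a phase as the only dependence on \<open>k\<close>. Summing over \<open>k\<close>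
  kills every \<open>s\<close> with \<open>s * symp v w\<close> nonzero; as \<open>symp v w\<close>
  is nonzero, only \<open>s = 0\<close> remains, with weight d.\<close>

lemma intertwiner_unitary:
  assumes "symp v w \<noteq> 0"
  shows "unitary (intertwiner P Q)"
proof (rule unitaryI)
  let ?d = "CARD('p)"
  let ?S = "\<Sum>k\<in>UNIV. P k ** Q (- k)" and ?T = "\<Sum>k\<in>UNIV. Q k ** P (- k)"
  have "?S ** ?T = (\<Sum>k\<in>UNIV. \<Sum>l\<in>UNIV. P k ** (Q (l - k) ** P (- l)))"
    by (simp add: matrix_mult_sum_left matrix_mult_sum_right matrix_mul_assoc[symmetric]
        weyl_rep_add_assoc[OF Q]) (rule sum.swap)
  also have "\<dots> = (\<Sum>k\<in>UNIV. \<Sum>s\<in>UNIV. P k ** (Q s ** P (- (k + s))))"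
  proof (rule sum.cong[OF refl])
    fix k
    show "(\<Sum>l\<in>UNIV. P k ** (Q (l - k) ** P (- l))) = (\<Sum>s\<in>UNIV. P k ** (Q s ** P (- (k + s))))"
      by (rule sum.reindex_bij_witness[of _ "\<lambda>s. k + s" "\<lambda>l. l - k"]) auto
  qed
  also have "\<dots> = (\<Sum>k\<in>UNIV. \<Sum>s\<in>UNIV. mat (chi (k * (s * symp v w))) ** (Q s ** P (- s)))"
  proof (intro sum.cong refl)
    fix k s
    have "P k ** (Q s ** P (- (k + s))) = (P k ** Q s) ** P (- (k + s))"
      by (simp add: matrix_mul_assoc)
    also have "\<dots> = mat (chi (k * (s * symp v w))) ** (Q s ** (P k ** P (- (k + s))))"
      unfolding weyl_rep_commute2[OF P Q] by (simp add: matrix_mul_assoc mult.assoc)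
    finally show "P k ** (Q s ** P (- (k + s))) = mat (chi (k * (s * symp v w))) ** (Q s ** P (- s))"
      by (simp add: weyl_rep_add[OF P])
  qed
  also have "\<dots> = (\<Sum>s\<in>UNIV. mat (if s = 0 then of_nat ?d else 0) ** (Q s ** P (- s)))"
    using assms by (subst sum.swap) (simp add: sum_matrix_smult sum_chi)
  also have "\<dots> = (\<Sum>s\<in>(UNIV :: 'p mod_ring set). if s = 0 then mat (of_nat ?d) else 0)"
    by (rule sum.cong) (auto simp: weyl_rep_0[OF P] weyl_rep_0[OF Q] mat_mult_mat vec_eq_iff[of _ 0] mat_mult_nth)
  finally have ST: "?S ** ?T = mat (of_nat ?d)" by simp
  have "intertwiner P Q ** intertwiner Q P =
      mat (of_real (1 / sqrt ?d) * of_real (1 / sqrt ?d)) ** (?S ** ?T)"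
    unfolding intertwiner_def by (simp add: mat_left_commute[of ?S] mat_simps)
  also have "\<dots> = mat (complex_of_real (1 / sqrt ?d * (1 / sqrt ?d) * ?d))"
    unfolding ST mat_mult_mat by (simp only: of_real_mult of_real_of_nat_eq)
  also have "1 / sqrt ?d * (1 / sqrt ?d) * ?d = 1"
    by (simp add: field_simps)
  finally show "intertwiner P Q ** adj (intertwiner P Q) = mat 1"
    by (simp add: adj_intertwiner)
qed

text \<open>\<open>weyl x\<close> is \<open>P a\<close> times an operator that commutes with the
  intertwiner, and intertwining turns \<open>P a\<close> into \<open>Q a\<close>. The conjugate is
  thus a product of Weyl operators.\<close>

lemma intertwiner_conj_weyl:
  assumes "symp v w \<noteq> 0"
  shows "is_weyl (adj (intertwiner P Q) ** weyl x ** intertwiner P Q)"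
proof -
  let ?U = "intertwiner P Q"
  \<comment> \<open>\<open>a\<close> is chosen so that \<open>P (- a) ** weyl x\<close> commutes with every term of the sum.\<close>
  define a where "a = (symp x v - symp x w) / symp w v"
  have wv: "symp w v \<noteq> 0"
    using assms symp_swap[of v w] by simp
  have comm: "(P (- a) ** weyl x) ** (P k ** Q (- k)) = (P k ** Q (- k)) ** (P (- a) ** weyl x)" for k
  proof -
    have 1: "weyl x ** (P k ** Q (- k)) = mat (chi (k * symp x v - k * symp x w)) ** (P k ** Q (- k) ** weyl x)"
    proof -
      have "weyl x ** (P k ** Q (- k)) = (weyl x ** P k) ** Q (- k)"
        by (simp add: matrix_mul_assoc)
      also have "\<dots> = mat (chi (k * symp x v)) ** (P k ** (weyl x ** Q (- k)))"
        by (simp add: weyl_rep_commute[OF P] matrix_mul_assoc)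
      also have "\<dots> = mat (chi (k * symp x v) * chi (- k * symp x w)) ** (P k ** Q (- k) ** weyl x)"
        by (simp add: weyl_rep_commute[OF Q] mat_left_commute[of "P k"] mat_simps matrix_mul_assoc[symmetric])
      finally show ?thesis
        by (simp add: chi_add[symmetric])
    qed
    have 2: "P (- a) ** (P k ** Q (- k)) = mat (chi (- (k * a * symp w v))) ** (P k ** Q (- k) ** P (- a))"
    proof -
      have "P (- a) ** (P k ** Q (- k)) = P k ** (P (- a) ** Q (- k))"
        by (simp add: weyl_rep_add_assoc[OF P] add.commute)
      also have "\<dots> = mat (chi (k * a * symp v w)) ** (P k ** Q (- k) ** P (- a))"
        unfolding weyl_rep_commute2[OF P Q, of "- a"] mat_left_commute[of "P k"]
        by (simp add: matrix_mul_assoc[symmetric] mult_ac)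
      finally show ?thesis
        by (simp add: symp_swap[of v w])
    qed
    have "(P (- a) ** weyl x) ** (P k ** Q (- k)) =
        P (- a) ** (weyl x ** (P k ** Q (- k)))"
      by (simp add: matrix_mul_assoc)
    also have "\<dots> = mat (chi (k * symp x v - k * symp x w)) ** ((P (- a) ** (P k ** Q (- k))) ** weyl x)"
      unfolding 1 mat_left_commute[of "P _"] by (simp add: matrix_mul_assoc)
    also have "\<dots> = mat (chi (k * symp x v - k * symp x w) * chi (- (k * a * symp w v))) **
        (P k ** Q (- k) ** (P (- a) ** weyl x))"
      unfolding 2 by (simp add: mat_simps matrix_mul_assoc[symmetric])
    also have "chi (k * symp x v - k * symp x w) * chi (- (k * a * symp w v)) = 1"
      using wv by (simp add: chi_add[symmetric] a_def algebra_simps)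
    finally show ?thesis by simp
  qed
  have "(P (- a) ** weyl x) ** ?U = ?U ** (P (- a) ** weyl x)"
    unfolding intertwiner_def mat_left_commute[of "P _ ** _"] 
    by (simp add: matrix_mult_sum_left matrix_mult_sum_right comm mat_simps)
  then have "P a ** ((P (- a) ** weyl x) ** ?U) = (P a ** ?U) ** (P (- a) ** weyl x)"
    by (simp add: matrix_mul_assoc)
  then have "weyl x ** ?U = ?U ** (Q a ** (P (- a) ** weyl x))"
    by (simp add: matrix_mul_assoc[symmetric] weyl_rep_add_assoc[OF P] weyl_rep_0[OF P]
        intertwiner_intertwines)
  then have "adj ?U ** weyl x ** ?U = Q a ** (P (- a) ** weyl x)"
    by (simp add: matrix_mul_assoc[symmetric] unitary_cancel[OF intertwiner_unitary[OF assms]])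
  then show ?thesis
    by (simp add: is_weyl_mult weyl_rep_is_weyl[OF P] weyl_rep_is_weyl[OF Q] is_weyl_weyl)
qed

end

lemma clifford_op_intertwiner:
  assumes "weyl_rep P v" "weyl_rep Q w" "symp v w \<noteq> 0"
  shows "clifford_op (intertwiner P Q)"
proof -
  have "symp w v \<noteq> 0"
    using assms(3) symp_swap[of v w] by simp
  then show ?thesis
    unfolding clifford_op_def
    using intertwiner_conj_weyl[OF assms(1,2)] intertwiner_conj_weyl[OF assms(2,1)]
      intertwiner_unitary[OF assms(1,2)] adj_intertwiner[OF assms(1,2)] adj_intertwiner[OF assms(2,1)] assms(3)
    by simp
qed

text \<open>The scalar \<open>\<beta>\<close> absorbs the normalising phases of \<open>P 1\<close>
  and \<open>Q 1\<close>. The relation is kept free of inverses because the analysis of a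
  measurement takes it in this form, with \<open>v = zdir j0\<close>.\<close>

lemma clifford_transitive_step:
  assumes "symp v w \<noteq> 0"
  shows "\<exists>U \<beta>. clifford_op U \<and> cmod \<beta> = 1 \<and> weyl v ** U = mat \<beta> ** (U ** weyl w)"
proof -
  obtain P Q where PQ: "weyl_rep P v" "weyl_rep Q w"
    using weyl_rep_exists by metis
  let ?U = "intertwiner P Q"
  obtain a b where a: "cmod a = 1" "P 1 = mat a ** weyl v" and b: "cmod b = 1" "Q 1 = mat b ** weyl w"
    using weyl_rep_weyl[OF PQ(1), of 1] weyl_rep_weyl[OF PQ(2), of 1] by auto
  have "mat a ** (weyl v ** ?U) = mat b ** (?U ** weyl w)"
    using intertwiner_intertwines[OF PQ, of 1] unfolding a b
    by (simp add: mat_simps mat_left_commute[of ?U])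
  then have "mat (cnj a) ** (mat a ** (weyl v ** ?U)) = mat (cnj a) ** (mat b ** (?U ** weyl w))"
    by simp
  then have "weyl v ** ?U = mat (cnj a * b) ** (?U ** weyl w)"
    by (simp add: mat_simps cnj_mult_self a)
  moreover have "cmod (cnj a * b) = 1"
    using a b by (simp add: norm_mult)
  ultimately show ?thesis
    using clifford_op_intertwiner[OF PQ assms] by blast
qed

text \<open>Two commuting directions are exchanged through a third one that commutes with neither.\<close>

lemma clifford_transitive:
  assumes "v \<noteq> 0" "w \<noteq> 0"
  shows "\<exists>U \<beta>. clifford_op U \<and> cmod \<beta> = 1 \<and> weyl v ** U = mat \<beta> ** (U ** weyl w)"
proof -
  obtain u where u: "symp u v \<noteq> 0" "symp u w \<noteq> 0"
    using symp_common_nonorthogonal[OF assms] .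
  then have "symp v u \<noteq> 0"
    using symp_swap[of v u] by simp
  then obtain U a where U: "clifford_op U" "cmod a = 1" "weyl v ** U = mat a ** (U ** weyl u)"
    using clifford_transitive_step by blast
  obtain V b where V: "clifford_op V" "cmod b = 1" "weyl u ** V = mat b ** (V ** weyl w)"
    using clifford_transitive_step[OF u(2)] by blast
  have "weyl v ** (U ** V) = mat a ** (U ** (weyl u ** V))"
    by (simp add: matrix_mul_assoc U)
  also have "\<dots> = mat (a * b) ** (U ** V ** weyl w)"
    unfolding V by (simp add: mat_left_commute[of U] mat_simps matrix_mul_assoc[symmetric])
  finally show ?thesis
    using U V clifford_op_mult[of U V] by (intro exI[of _ "U ** V"] exI[of _ "a * b"]) (simp add: norm_mult)
qed

subsection \<open>The projective groups\<close>

lemma unitary_group_simps [simp]: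
  "carrier unitary_group = {U. unitary U}"
  "A \<otimes>\<^bsub>unitary_group\<^esub> B = A ** B"
  "\<one>\<^bsub>unitary_group\<^esub> = mat 1"
  by (simp_all add: unitary_group_def)

lemma group_unitary_group: "group (unitary_group :: ('i::finite op) monoid)"
proof (rule groupI)
  fix x :: "'i op" assume "x \<in> carrier unitary_group"
  then show "\<exists>y\<in>carrier unitary_group. y \<otimes>\<^bsub>unitary_group\<^esub> x = \<one>\<^bsub>unitary_group\<^esub>"
    by (intro bexI[of _ "adj x"]) (auto simp: unitaryD unitary_adj)
qed (use unitary_mat[of 1] in \<open>auto simp: unitary_mult matrix_mul_assoc\<close>)

lemma inv_unitary_group: "unitary U \<Longrightarrow> inv\<^bsub>unitary_group\<^esub> U = adj U"
  by (rule group.inv_equality[OF group_unitary_group]) (simp_all add: unitaryD unitary_adj)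

lemma phases_normal: "phases \<lhd> (unitary_group :: ('i::finite op) monoid)"
proof -
  have "subgroup phases (unitary_group :: ('i op) monoid)"
  proof (rule group.subgroupI[OF group_unitary_group])
    show "(phases :: 'i op set) \<subseteq> carrier unitary_group"
      by (auto simp: phases_def unitary_mat)
    show "(phases :: 'i op set) \<noteq> {}"
      by (auto simp: phases_def intro: exI[of _ 1])
  next
    fix a :: "'i op" assume "a \<in> phases"
    then obtain c where "a = mat c" "cmod c = 1" by (auto simp: phases_def)
    then show "inv\<^bsub>unitary_group\<^esub> a \<in> phases"
      by (auto simp: phases_def inv_unitary_group unitary_mat intro!: exI[of _ "cnj c"])
  next
    fix a b :: "'i op" assume "a \<in> phases" "b \<in> phases"
    then show "a \<otimes>\<^bsub>unitary_group\<^esub> b \<in> phases"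
      by (auto simp: phases_def mat_mult_mat) (metis mult_1 norm_mult)
  qed
  moreover have "x \<otimes>\<^bsub>unitary_group\<^esub> h \<otimes>\<^bsub>unitary_group\<^esub> inv\<^bsub>unitary_group\<^esub> x \<in> phases"
    if "unitary x" "h \<in> phases" for x h :: "'i op"
  proof -
    from that(2) obtain c where "h = mat c" "cmod c = 1" by (auto simp: phases_def)
    with that(1) show ?thesis
      by (auto simp: inv_unitary_group mat_commute[of x] mat_simps unitaryD phases_def)
  qed
  ultimately show ?thesis
    by (auto simp: group.normal_inv_iff[OF group_unitary_group])
qed

definition cls :: "'i::finite op \<Rightarrow> 'i op set" where
  "cls U = phases #>\<^bsub>unitary_group\<^esub> U"

lemma mem_cls: "A \<in> cls U \<longleftrightarrow> (\<exists>c. cmod c = 1 \<and> A = mat c ** U)"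
  by (auto simp: cls_def r_coset_def phases_def)

lemma self_mem_cls: "U \<in> cls U"
  unfolding mem_cls by (intro exI[of _ 1]) simp

lemma cls_eq_iff: "cls U = cls V \<longleftrightarrow> (\<exists>c. cmod c = 1 \<and> U = mat c ** V)"
proof
  assume "cls U = cls V"
  then show "\<exists>c. cmod c = 1 \<and> U = mat c ** V"
    using self_mem_cls[of U] by (simp add: mem_cls)
next
  assume "\<exists>c. cmod c = 1 \<and> U = mat c ** V"
  then obtain c where c: "cmod c = 1" "U = mat c ** V" by blast
  then have V: "V = mat (cnj c) ** U"
    by (simp add: mat_simps cnj_mult_self)
  have "mat e ** U = mat (e * c) ** V" "mat e ** V = mat (e * cnj c) ** U" for e
    by (simp add: c mat_simps) (simp add: V[symmetric] mat_mult_mat[symmetric] matrix_mul_assoc[symmetric])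
  with c show "cls U = cls V"
    unfolding set_eq_iff mem_cls by (metis complex_mod_cnj mult_1 norm_mult)
qed

lemma carrier_PU: "carrier PU = cls ` {U. unitary U}"
  by (simp add: PU_def carrier_FactGroup cls_def[abs_def])

lemma PU_mult: "unitary U \<Longrightarrow> unitary V \<Longrightarrow> cls U \<otimes>\<^bsub>PU\<^esub> cls V = cls (U ** V)"
  using normal.rcos_sum[OF phases_normal, of U V] by (simp add: PU_def cls_def)

lemma PU_one: "\<one>\<^bsub>PU\<^esub> = cls (mat 1)"
  by (auto simp: PU_def mem_cls phases_def set_eq_iff)

lemma group_PU: "group PU"
  unfolding PU_def by (rule normal.factorgroup_is_group[OF phases_normal])

lemma PU_inv: "unitary U \<Longrightarrow> inv\<^bsub>PU\<^esub> (cls U) = cls (adj U)"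
  by (rule group.inv_equality[OF group_PU])
    (auto simp: PU_mult PU_one unitary_adj unitaryD carrier_PU)

lemma pauli_group_eq: "pauli_group = range (\<lambda>v. cls (weyl v))"
  by (auto simp: pauli_group_def cls_def pauli_string_eq_weyl)

lemma conj_pauli_group:
  assumes U: "unitary U"
  shows "(cls U <#\<^bsub>PU\<^esub> pauli_group) #>\<^bsub>PU\<^esub> inv\<^bsub>PU\<^esub> (cls U) =
    range (\<lambda>v. cls (U ** weyl v ** adj U))"
proof -
  have "cls U \<otimes>\<^bsub>PU\<^esub> cls (weyl v) \<otimes>\<^bsub>PU\<^esub> inv\<^bsub>PU\<^esub> (cls U) = cls (U ** weyl v ** adj U)" for v
    using U by (simp add: PU_mult PU_inv weyl_unitary unitary_mult unitary_adj)
  then show ?thesis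
    by (auto simp: l_coset_def r_coset_def pauli_group_eq)
qed

lemma is_weyl_iff_cls: "is_weyl A \<longleftrightarrow> cls A \<in> pauli_group"
proof -
  have "is_weyl A \<longleftrightarrow> (\<exists>v. cls A = cls (weyl v))"
    unfolding is_weyl_def cls_eq_iff by blast
  then show ?thesis
    unfolding pauli_group_eq by blast
qed

text \<open>Solves for the preimage under conjugation: that every Pauli class is attained becomes
  membership in the Pauli group for the inverse conjugation.\<close>

lemma cls_conj_swap:
  assumes U: "unitary U"
  shows "cls A = cls (U ** B ** adj U) \<longleftrightarrow> cls (adj U ** A ** U) = cls B"
proof -
  have "A = mat c ** (U ** B ** adj U) \<longleftrightarrow> adj U ** A ** U = mat c ** B" for c
  proof
    assume "A = mat c ** (U ** B ** adj U)"
    then show "adj U ** A ** U = mat c ** B"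
      using U by (simp add: mat_left_commute[of "adj U"] mat_simps matrix_mul_assoc[symmetric] unitary_cancel unitaryD)
  next
    assume *: "adj U ** A ** U = mat c ** B"
    have "A = U ** (adj U ** A ** U) ** adj U"
      using U by (simp add: matrix_mul_assoc[symmetric] unitary_cancel unitaryD)
    then show "A = mat c ** (U ** B ** adj U)"
      unfolding * by (simp add: mat_left_commute[of U] mat_simps)
  qed
  then show ?thesis
    unfolding cls_eq_iff by blast
qed

lemma cls_clifford_iff:
  fixes U :: "('n::finite \<Rightarrow> 'p::prime_card mod_ring) op"
  assumes U: "unitary U"
  shows "cls U \<in> clifford_group \<longleftrightarrow> clifford_op U"
proof -
  have UP: "cls U \<in> carrier PU"
    using U by (auto simp: carrier_PU)
  have P: "(pauli_group :: ('n \<Rightarrow> 'p mod_ring) op set set) \<subseteq> carrier PU"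
    by (auto simp: pauli_group_eq carrier_PU weyl_unitary)
  have "cls U \<in> clifford_group \<longleftrightarrow>
      range (\<lambda>v. cls (U ** weyl v ** adj U)) = pauli_group"
    unfolding clifford_group_def normalizer_def stabilizer_def
    using UP P by (simp add: conj_pauli_group[OF U])
  also have "\<dots> \<longleftrightarrow> (\<forall>v. cls (U ** weyl v ** adj U) \<in> pauli_group) \<and>
      (\<forall>v. \<exists>w. cls (weyl v) = cls (U ** weyl w ** adj U))"
    by (simp add: set_eq_subset[of "range _"] pauli_group_eq image_subset_iff image_iff del: split_paired_All split_paired_Ex)
  also have "(\<forall>v. \<exists>w. cls (weyl v) = cls (U ** weyl w ** adj U)) \<longleftrightarrow>
      (\<forall>v. is_weyl (adj U ** weyl v ** U))"
    by (simp add: is_weyl_iff_cls cls_conj_swap[OF U] pauli_group_eq image_iff)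
  also have "(\<forall>v. cls (U ** weyl v ** adj U) \<in> pauli_group) \<longleftrightarrow>
      (\<forall>v. is_weyl (U ** weyl v ** adj U))"
    by (simp add: is_weyl_iff_cls)
  finally have "cls U \<in> clifford_group \<longleftrightarrow>
      (\<forall>v. is_weyl (U ** weyl v ** adj U)) \<and> (\<forall>v. is_weyl (adj U ** weyl v ** U))" .
  then show ?thesis
    using U unfolding clifford_op_def by blast
qed

lemma clifford_group_eq: "clifford_group = cls ` {U. clifford_op U}"
proof -
  have "clifford_group \<subseteq> carrier PU"
    by (auto simp: clifford_group_def normalizer_def stabilizer_def)
  then show ?thesis
    using cls_clifford_iff by (auto simp: carrier_PU clifford_op_unitary)
qed

lemma unitary_rep_cls: "\<exists>c. cmod c = 1 \<and> unitary_rep (cls U) = mat c ** U"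
proof -
  have "unitary_rep (cls U) \<in> cls U"
    unfolding unitary_rep_def by (rule someI[of _ U]) (rule self_mem_cls)
  then show ?thesis
    by (simp add: mem_cls)
qed

lemma clifford_op_unitary_rep:
  assumes "C \<in> clifford_group"
  shows "clifford_op (unitary_rep C)"
proof -
  obtain U where U: "clifford_op U" "C = cls U"
    using assms by (auto simp: clifford_group_eq)
  obtain c where c: "cmod c = 1" "unitary_rep C = mat c ** U"
    using unitary_rep_cls U(2) by blast
  then have "cls (unitary_rep C) = C" "unitary (unitary_rep C)"
    using U by (auto simp: cls_eq_iff unitary_mult unitary_mat clifford_op_unitary)
  then show ?thesis
    using assms cls_clifford_iff by metis
qed

section \<open>Rays\<close>

lemma span_singleton_cvec: "vec.span {\<psi>} = range (\<lambda>c. c *s \<psi>)"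
  for \<psi> :: "complex ^ 'i::finite"
  by (rule vec.span_singleton)

lemma Rep_ray: "\<psi> \<noteq> 0 \<Longrightarrow> Rep_cproj (ray \<psi>) = range (\<lambda>c. c *s \<psi>)"
  unfolding ray_def span_singleton_cvec[symmetric] by (rule Abs_cproj_inverse) blast

lemma ray_smult:
  assumes "a \<noteq> 0"
  shows "ray (a *s \<psi>) = ray \<psi>"
proof -
  have "range (\<lambda>c. c *s (a *s \<psi>)) = (\<lambda>c. c *s \<psi>) ` range (\<lambda>c. c * a)"
    by (simp add: image_image vector_smult_assoc)
  also have "range (\<lambda>c. c * a) = UNIV"
    using assms by (intro surjI[of _ "\<lambda>c. c / a"]) simp
  finally show ?thesis
    unfolding ray_def span_singleton_cvec by simp
qed

lemma ray_eqD:
  assumes "ray \<psi> = ray \<phi>" "\<psi> \<noteq> 0" "\<phi> \<noteq> 0"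
  obtains a where "a \<noteq> 0" "\<psi> = a *s \<phi>"
proof -
  have "\<psi> = 1 *s \<psi>" by simp
  then have "\<psi> \<in> range (\<lambda>c. c *s \<psi>)" by (rule range_eqI)
  then have "\<psi> \<in> range (\<lambda>c. c *s \<phi>)"
    using assms by (simp add: Rep_ray[symmetric])
  then obtain a where "\<psi> = a *s \<phi>" by blast
  with assms(2) that[of a] show thesis by auto
qed

lemma unit_rep: "norm (unit_rep x) = 1 \<and> ray (unit_rep x) = x"
proof -
  obtain \<psi> where \<psi>: "\<psi> \<noteq> 0" "x = Abs_cproj (vec.span {\<psi>})"
    by (cases x) blast
  let ?c = "complex_of_real (1 / norm \<psi>)"
  have "norm (?c *s \<psi>) = 1 \<and> ray (?c *s \<psi>) = x"
    using \<psi> by (subst ray_smult) (auto simp: norm_cvec_smult norm_divide ray_def)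
  then show ?thesis
    unfolding unit_rep_def by (rule someI)
qed

lemma unit_rep_nonzero: "unit_rep x \<noteq> 0"
  using unit_rep[of x] by force

lemma unit_rep_ray:
  assumes "\<psi> \<noteq> 0"
  obtains a where "a \<noteq> 0" "unit_rep (ray \<psi>) = a *s \<psi>"
  using ray_eqD[of "unit_rep (ray \<psi>)" \<psi>] unit_rep[of "ray \<psi>"] unit_rep_nonzero assms by metis

section \<open>Isotropic subspaces of phase space\<close>

declare split_paired_All [simp del] split_paired_Ex [simp del]

text \<open>Translation by an \<open>a\<close> with \<open>f a \<noteq> 0\<close> multiplies the sum
  by a factor different from 1. This general orthogonality relation serves for subspaces, for the
  whole phase space and for strings.\<close>

lemma sum_chi_additive:
  fixes f :: "'a::ab_group_add \<Rightarrow> 'p::prime_card mod_ring"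
  assumes A: "finite A" "\<And>x y. x \<in> A \<Longrightarrow> y \<in> A \<Longrightarrow> x + y \<in> A" "\<And>x. x \<in> A \<Longrightarrow> - x \<in> A"
    and f: "\<And>x y. f (x + y) = f x + f y"
  shows "(\<Sum>x\<in>A. chi (f x)) = (if \<forall>x\<in>A. f x = 0 then of_nat (card A) else 0)"
proof (cases "\<forall>x\<in>A. f x = 0")
  case False
  then obtain a where a: "a \<in> A" "f a \<noteq> 0" by blast
  let ?S = "\<Sum>x\<in>A. chi (f x)"
  have "x - a \<in> A" if "x \<in> A" for x
    using A(2)[OF that A(3)[OF a(1)]] by simp
  then have "?S = (\<Sum>x\<in>A. chi (f (x + a)))"
    using a(1) A(2) by (intro sum.reindex_bij_witness[of _ "\<lambda>x. x + a" "\<lambda>x. x - a"]) auto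
  also have "\<dots> = chi (f a) * ?S"
    by (simp add: f chi_add sum_distrib_left mult.commute[of "chi (f a)"])
  finally have "(chi (f a) - 1) * ?S = 0"
    by (simp add: algebra_simps)
  with a show ?thesis by auto
qed simp

definition phase_subspace :: "('n::finite, 'p::prime_card) phase_space set \<Rightarrow> bool" where
  "phase_subspace S \<longleftrightarrow>
     0 \<in> S \<and> (\<forall>u\<in>S. \<forall>v\<in>S. u + v \<in> S) \<and> (\<forall>a. \<forall>v\<in>S. scal a v \<in> S)"

definition perp :: "('n::finite, 'p::prime_card) phase_space set \<Rightarrow> ('n, 'p) phase_space set" where
  "perp S = {v. \<forall>s\<in>S. symp s v = 0}"

lemma scal_uminus_1: "scal (- 1) v = - v"
  by (simp add: scal_def prod_eq_iff fun_eq_iff)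

lemma phase_subspace_uminus: "phase_subspace S \<Longrightarrow> v \<in> S \<Longrightarrow> - v \<in> S"
  unfolding phase_subspace_def by (metis scal_uminus_1)

lemma card_phase_space:
  "CARD(('n::finite, 'p::prime_card) phase_space) = CARD('p) ^ CARD('n) * CARD('p) ^ CARD('n)"
  by (simp add: card_fun)

text \<open>Double counting of \<open>chi (symp s v)\<close> over \<open>s \<in> S\<close> and all
  \<open>v\<close>. Summing over \<open>s\<close> first detects \<open>v \<in> perp S\<close>;
  summing over \<open>v\<close> first leaves only \<open>s = 0\<close>, by nondegeneracy.\<close>

lemma card_perp:
  fixes S :: "('n::finite, 'p::prime_card) phase_space set"
  assumes S: "phase_subspace S"
  shows "card S * card (perp S) = (CARD('p) ^ CARD('n))\<^sup>2"
proof -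
  have "(\<Sum>v\<in>UNIV. \<Sum>s\<in>S. chi (symp s v)) =
      (\<Sum>v\<in>UNIV. if v \<in> perp S then complex_of_nat (card S) else 0)"
  proof (rule sum.cong[OF refl])
    fix v
    show "(\<Sum>s\<in>S. chi (symp s v)) = (if v \<in> perp S then complex_of_nat (card S) else 0)"
      using S phase_subspace_uminus[OF S]
      by (subst sum_chi_additive) (auto simp: symp_add_left perp_def phase_subspace_def)
  qed
  also have "\<dots> = of_nat (card S * card (perp S))"
    by (simp add: sum.If_cases)
  finally have 1: "(\<Sum>v\<in>UNIV. \<Sum>s\<in>S. chi (symp s v)) = of_nat (card S * card (perp S))" .
  have "(\<Sum>s\<in>S. \<Sum>v\<in>UNIV. chi (symp s v)) =
      (\<Sum>s\<in>S. if s = 0 then complex_of_nat CARD(('n, 'p) phase_space) else 0)"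
  proof (rule sum.cong[OF refl])
    fix s :: "('n, 'p) phase_space"
    have "(\<forall>v. symp s v = 0) \<longleftrightarrow> s = 0"
    proof (rule iffI, rule ccontr)
      assume *: "\<forall>v. symp s v = 0" "s \<noteq> 0"
      obtain w where "symp w s \<noteq> 0" using symp_nondegenerate[OF *(2)] .
      with * show False by (simp add: symp_swap[of w s])
    qed simp
    then show "(\<Sum>v\<in>UNIV. chi (symp s v)) =
        (if s = 0 then complex_of_nat CARD(('n, 'p) phase_space) else 0)"
      by (subst sum_chi_additive) (auto simp: symp_add_right)
  qed
  also have "\<dots> = of_nat CARD(('n, 'p) phase_space)"
    using S by (simp add: phase_subspace_def)
  finally have 2: "(\<Sum>s\<in>S. \<Sum>v\<in>UNIV. chi (symp s v)) = of_nat CARD(('n, 'p) phase_space)" .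
  have "complex_of_nat (card S * card (perp S)) = of_nat CARD(('n, 'p) phase_space)"
    unfolding 1[symmetric] 2[symmetric] by (rule sum.swap)
  then show ?thesis
    unfolding of_nat_eq_iff card_phase_space power2_eq_square .
qed

lemma isotropic_card_le:
  fixes S :: "('n::finite, 'p::prime_card) phase_space set"
  assumes "phase_subspace S" "S \<subseteq> perp S"
  shows "card S \<le> CARD('p) ^ CARD('n)"
proof -
  have "card S \<le> card (perp S)"
    using assms(2) by (intro card_mono) auto
  then have "card S * card S \<le> card S * card (perp S)"
    by simp
  then have "(card S)\<^sup>2 \<le> (CARD('p) ^ CARD('n))\<^sup>2"
    by (simp add: card_perp[OF assms(1)] power2_eq_square[of "card S"])
  then show ?thesis
    by (simp add: power2_le_iff_abs_le)
qed

lemma isotropic_maximal: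
  fixes S :: "('n::finite, 'p::prime_card) phase_space set"
  assumes "phase_subspace S" "S \<subseteq> perp S" "card S = CARD('p) ^ CARD('n)"
  shows "perp S = S"
proof -
  have "card S > 0"
    using assms(1) by (auto simp: phase_subspace_def card_gt_0_iff)
  then have "card (perp S) = card S"
    using card_perp[OF assms(1)] unfolding assms(3)[symmetric] by (auto simp: power2_eq_square)
  then show ?thesis
    using card_subset_eq[OF _ assms(2)] by simp
qed

text \<open>The product formula makes \<open>perp S\<close> strictly larger than a subspace with
  fewer than d^N elements. The direction found here is the one whose measurement raises the
  count.\<close>

lemma isotropic_extendable:
  fixes S :: "('n::finite, 'p::prime_card) phase_space set"
  assumes "phase_subspace S" "card S < CARD('p) ^ CARD('n)"
  obtains v where "v \<in> perp S" "v \<notin> S"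
proof -
  have "card (perp S) > card S"
  proof (rule ccontr)
    assume "\<not> card (perp S) > card S"
    then have "card S * card (perp S) \<le> card S * card S" by simp
    also have "\<dots> < (CARD('p) ^ CARD('n))\<^sup>2"
      using assms(2) by (simp add: power2_eq_square mult_strict_mono)
    finally show False
      using card_perp[OF assms(1)] by simp
  qed
  then have "\<not> perp S \<subseteq> S"
    using card_mono[of S "perp S"] by auto
  with that show thesis by blast
qed

section \<open>Eigendirections of a vector\<close>

definition eigendirs ::
  "complex ^ ('n::finite \<Rightarrow> 'p::prime_card mod_ring) \<Rightarrow> ('n, 'p) phase_space set" where
  "eigendirs \<psi> = {v. \<exists>c. weyl v *v \<psi> = c *s \<psi>}"

lemma eigendirs_smult:
  assumes "a \<noteq> 0"
  shows "eigendirs (a *s \<psi>) = eigendirs \<psi>"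
proof -
  have "weyl v *v (a *s \<psi>) = c *s (a *s \<psi>) \<longleftrightarrow> weyl v *v \<psi> = c *s \<psi>" for v c
  proof -
    have "weyl v *v (a *s \<psi>) = c *s (a *s \<psi>) \<longleftrightarrow> a *s (weyl v *v \<psi>) = a *s (c *s \<psi>)"
      by (simp add: matrix_vector_mult_smult vector_smult_assoc mult.commute)
    also have "\<dots> \<longleftrightarrow> weyl v *v \<psi> = c *s \<psi>"
      using assms by (simp only: vector_mul_lcancel) simp
    finally show ?thesis .
  qed
  then show ?thesis
    by (simp add: eigendirs_def)
qed

lemma eigendirs_unit_rep: "\<psi> \<noteq> 0 \<Longrightarrow> eigendirs (unit_rep (ray \<psi>)) = eigendirs \<psi>"
  using unit_rep_ray[of \<psi>] eigendirs_smult by metis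

lemma eigendirs_add:
  assumes "v \<in> eigendirs \<psi>" "w \<in> eigendirs \<psi>"
  shows "v + w \<in> eigendirs \<psi>"
proof -
  obtain a b where ab: "weyl v *v \<psi> = a *s \<psi>" "weyl w *v \<psi> = b *s \<psi>"
    using assms by (auto simp: eigendirs_def)
  obtain c where c: "cmod c = 1" "weyl v ** weyl w = mat c ** weyl (v + w)"
    using weyl_ex_mult by blast
  have "weyl (v + w) = mat (cnj c) ** (weyl v ** weyl w)"
    by (simp add: c mat_simps cnj_mult_self)
  then have "weyl (v + w) *v \<psi> = (cnj c * b * a) *s \<psi>"
    by (simp add: matrix_vector_mul_assoc[symmetric] ab matrix_vector_mult_smult mat_vec
        vector_smult_assoc mult_ac)
  then show ?thesis
    unfolding eigendirs_def by blast
qed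

lemma zero_eigendirs: "0 \<in> eigendirs \<psi>"
  unfolding eigendirs_def by (auto intro: exI[of _ 1])

lemma phase_subspace_eigendirs: "phase_subspace (eigendirs \<psi>)"
proof -
  have n: "scal (of_nat n) v \<in> eigendirs \<psi>" if "v \<in> eigendirs \<psi>" for n v
    by (induction n) (use that in \<open>auto simp: zero_eigendirs scal_add eigendirs_add\<close>)
  have "scal a v \<in> eigendirs \<psi>" if "v \<in> eigendirs \<psi>" for a v
    using n[OF that, of "fval a"] by simp
  then show ?thesis
    by (simp add: phase_subspace_def zero_eigendirs eigendirs_add)
qed

text \<open>Applying the two operators in either order gives the same nonzero multiple of
  \<open>\<psi>\<close>, so their commutation phase must be 1.\<close>

lemma symp_eigendirs:
  assumes "v \<in> eigendirs \<psi>" "w \<in> eigendirs \<psi>" "\<psi> \<noteq> 0"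
  shows "symp v w = 0"
proof -
  obtain a b where a: "weyl v *v \<psi> = a *s \<psi>" and b: "weyl w *v \<psi> = b *s \<psi>"
    using assms by (auto simp: eigendirs_def)
  have "a \<noteq> 0" "b \<noteq> 0"
    using unitary_eigenvalue[OF weyl_unitary a assms(3)] unitary_eigenvalue[OF weyl_unitary b assms(3)]
    by auto
  have "(weyl v ** weyl w) *v \<psi> = (mat (chi (symp v w)) ** (weyl w ** weyl v)) *v \<psi>"
    by (simp add: weyl_commute[symmetric])
  then have "(a * b) *s \<psi> = (chi (symp v w) * (a * b)) *s \<psi>"
    by (simp add: matrix_vector_mul_assoc[symmetric] a b matrix_vector_mult_smult mat_vec
        vector_smult_assoc mult_ac)
  with assms(3) \<open>a \<noteq> 0\<close> \<open>b \<noteq> 0\<close> show ?thesis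
    by (simp add: vector_mul_rcancel)
qed

lemma isotropic_eigendirs: "\<psi> \<noteq> 0 \<Longrightarrow> eigendirs \<psi> \<subseteq> perp (eigendirs \<psi>)"
  by (auto simp: perp_def symp_eigendirs)

text \<open>Irreducibility of the Weyl operators: the coefficients \<open>cnj (\<phi> t) * \<psi> (t - q)\<close> are recovered
  from the overlaps by Fourier inversion.\<close>

lemma weyl_orbit_total:
  fixes \<phi> \<psi> :: "complex ^ ('n::finite \<Rightarrow> 'p::prime_card mod_ring)"
  assumes "\<And>v. cip \<phi> (weyl v *v \<psi>) = 0" "\<psi> \<noteq> 0"
  shows "\<phi> = 0"
proof -
  have *: "cnj (\<phi> $ t) * \<psi> $ (t - q) = 0" for t q
  proof -
    define g where "g s = cnj (\<phi> $ s) * \<psi> $ (s - q)" for s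
    have 0: "(\<Sum>s\<in>UNIV. g s * chi (\<Sum>k\<in>UNIV. p k * s k)) = 0" for p
      using assms(1)[of "(p, q)"] unfolding cip_def weyl_mult_vec by (simp add: g_def mult_ac)
    have orth: "(\<Sum>p\<in>UNIV. chi (\<Sum>k\<in>UNIV. p k * (s - t) k)) =
        (if s = t then complex_of_nat CARD('n \<Rightarrow> 'p mod_ring) else 0)" for s
    proof -
      have "(\<forall>p. (\<Sum>k\<in>UNIV. p k * (s - t) k) = 0) \<longleftrightarrow> s = t"
      proof
        assume *: "\<forall>p. (\<Sum>k\<in>UNIV. p k * (s - t) k) = 0"
        have "(s - t) j = 0" for j
          using *[rule_format, of "\<lambda>k. if k = j then 1 else 0"]
          by (simp add: if_distrib[of "\<lambda>x. x * _"] cong: if_cong)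
        then show "s = t" by (simp add: fun_eq_iff)
      qed simp
      then show ?thesis
        by (subst sum_chi_additive) (auto simp: distrib_right sum.distrib)
    qed
    have "0 = (\<Sum>p\<in>UNIV. chi (- (\<Sum>k\<in>UNIV. p k * t k)) * (\<Sum>s\<in>UNIV. g s * chi (\<Sum>k\<in>UNIV. p k * s k)))"
      by (simp add: 0)
    also have "\<dots> = (\<Sum>p\<in>UNIV. \<Sum>s\<in>UNIV. g s * chi (\<Sum>k\<in>UNIV. p k * (s - t) k))"
    proof (intro sum.cong refl)
      fix p
      have "chi (\<Sum>k\<in>UNIV. p k * (s - t) k) =
          chi (- (\<Sum>k\<in>UNIV. p k * t k)) * chi (\<Sum>k\<in>UNIV. p k * s k)" for s
        by (simp add: chi_add[symmetric] right_diff_distrib sum_subtractf)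
      then show "chi (- (\<Sum>k\<in>UNIV. p k * t k)) * (\<Sum>s\<in>UNIV. g s * chi (\<Sum>k\<in>UNIV. p k * s k)) =
          (\<Sum>s\<in>UNIV. g s * chi (\<Sum>k\<in>UNIV. p k * (s - t) k))"
        by (simp only: sum_distrib_left mult_ac)
    qed
    also have "\<dots> = (\<Sum>s\<in>UNIV. g s * (\<Sum>p\<in>UNIV. chi (\<Sum>k\<in>UNIV. p k * (s - t) k)))"
      by (subst sum.swap) (simp add: sum_distrib_left)
    also have "\<dots> = g t * of_nat CARD('n \<Rightarrow> 'p mod_ring)"
      unfolding orth by (simp add: if_distrib[of "\<lambda>x. _ * x"] cong: if_cong)
    finally show ?thesis
      by (simp add: g_def)
  qed
  obtain s where s: "\<psi> $ s \<noteq> 0"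
    using assms(2) by (auto simp: vec_eq_iff)
  have "\<phi> $ t = 0" for t
    using *[of t "t - s"] s by simp
  then show ?thesis
    by (simp add: vec_eq_iff)
qed

text \<open>The part \<open>\<xi>\<close> of \<open>\<phi>\<close> orthogonal to
  \<open>\<psi>\<close> is orthogonal to every \<open>weyl v *v \<psi>\<close>: to multiples of
  \<open>\<psi>\<close> by construction, and to the others because they lie in a different
  eigenspace of some \<open>weyl s\<close>. Irreducibility then gives
  \<open>\<xi> = 0\<close>.\<close>

lemma joint_eigenvector_unique:
  fixes \<phi> \<psi> :: "complex ^ ('n::finite \<Rightarrow> 'p::prime_card mod_ring)"
  assumes \<psi>: "\<psi> \<noteq> 0" and card: "card (eigendirs \<psi>) = CARD('p) ^ CARD('n)"
    and \<kappa>: "\<And>v. v \<in> eigendirs \<psi> \<Longrightarrow> weyl v *v \<psi> = \<kappa> v *s \<psi>"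
    and \<phi>: "\<And>v. v \<in> eigendirs \<psi> \<Longrightarrow> weyl v *v \<phi> = \<kappa> v *s \<phi>"
  shows "\<exists>a. \<phi> = a *s \<psi>"
proof -
  define a where "a = cip \<psi> \<phi> / cip \<psi> \<psi>"
  define \<xi> where "\<xi> = \<phi> - a *s \<psi>"
  have "cip \<psi> \<psi> \<noteq> 0"
    using \<psi> by (simp add: cip_self)
  then have orth: "cip \<psi> \<xi> = 0"
    by (simp add: \<xi>_def cip_diff_right a_def)
  have \<xi>: "weyl v *v \<xi> = \<kappa> v *s \<xi>" if "v \<in> eigendirs \<psi>" for v
    unfolding \<xi>_def matrix_vector_mult_diff_distrib matrix_vector_mult_smult \<kappa>[OF that] \<phi>[OF that]
    by (simp add: vec_eq_iff right_diff_distrib mult.left_commute)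
  have "cip \<xi> (weyl v *v \<psi>) = 0" for v
  proof (cases "v \<in> eigendirs \<psi>")
    case True
    have "cip \<xi> \<psi> = cnj (cip \<psi> \<xi>)"
      by (simp add: cip_def mult.commute)
    with orth show ?thesis by (simp add: \<kappa>[OF True])
  next
    case False
    \<comment> \<open>Maximality: the set of directions equals its own complement, so
      \<open>v\<close> outside it fails to commute with some member.\<close>
    then obtain s where s: "s \<in> eigendirs \<psi>" "symp s v \<noteq> 0"
      using isotropic_maximal[OF phase_subspace_eigendirs isotropic_eigendirs[OF \<psi>] card]
      unfolding perp_def by blast
    have 1: "cmod (\<kappa> s) = 1"
      by (rule unitary_eigenvalue[OF weyl_unitary \<kappa>[OF s(1)] \<psi>])
    have "cip \<xi> (weyl v *v \<psi>) = cip (weyl s *v \<xi>) (weyl s *v (weyl v *v \<psi>))"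
      by (simp add: cip_unitary weyl_unitary)
    also have "weyl s *v (weyl v *v \<psi>) = (mat (chi (symp s v)) ** (weyl v ** weyl s)) *v \<psi>"
      by (simp only: matrix_vector_mul_assoc weyl_commute[symmetric])
    also have "\<dots> = (chi (symp s v) * \<kappa> s) *s (weyl v *v \<psi>)"
      by (simp add: matrix_vector_mul_assoc[symmetric] mat_vec \<kappa>[OF s(1)] matrix_vector_mult_smult
          vector_smult_assoc)
    also have "cip (weyl s *v \<xi>) \<dots> = (cnj (\<kappa> s) * \<kappa> s) * chi (symp s v) * cip \<xi> (weyl v *v \<psi>)"
      by (simp add: \<xi>[OF s(1)])
    finally have "(1 - chi (symp s v)) * cip \<xi> (weyl v *v \<psi>) = 0"
      by (simp add: cnj_mult_self[OF 1] algebra_simps)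
    with s(2) show ?thesis by simp
  qed
  then have "\<xi> = 0"
    using weyl_orbit_total \<psi> by blast
  then show ?thesis
    by (auto simp: \<xi>_def)
qed

text \<open>The inequality form presents the stabilizer states as the top superlevel set of the
  count; isotropy turns it into equality. A given group \<open>\<L>\<close> is covered by the
  classes of eigendirections; conversely these classes form the group, with the eigenvalues as
  character.\<close>

lemma stabilizer_states_eq:
  "stabilizer_states = {x :: ('n::finite \<Rightarrow> 'p::prime_card mod_ring) cproj.
     CARD('p) ^ CARD('n) \<le> card (eigendirs (unit_rep x))}"
proof (intro Set.set_eqI iffI)
  fix x :: "('n \<Rightarrow> 'p mod_ring) cproj"
  let ?\<psi> = "unit_rep x"
  have Rep: "Rep_cproj x = range (\<lambda>c. c *s ?\<psi>)"
    using Rep_ray[OF unit_rep_nonzero, of x] unit_rep[of x] by simp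
  {
    assume "x \<in> stabilizer_states"
    then obtain \<L> \<kappa> where L: "maximal_isotropic \<L>"
        and R: "Rep_cproj x = {\<psi>. \<forall>A\<in>\<Union>\<L>. A *v \<psi> = \<kappa> A *s \<psi>}"
      unfolding stabilizer_states_def by blast
    have "?\<psi> \<in> Rep_cproj x"
      unfolding Rep by (rule range_eqI[of _ _ 1]) simp
    then have eig: "A *v ?\<psi> = \<kappa> A *s ?\<psi>" if "A \<in> \<Union>\<L>" for A
      using that unfolding R by blast
    have "\<L> \<subseteq> (\<lambda>v. cls (weyl v)) ` eigendirs ?\<psi>"
    proof
      fix C assume C: "C \<in> \<L>"
      then have "C \<in> pauli_group"
        using L by (auto simp: maximal_isotropic_def)
      then obtain v where v: "C = cls (weyl v)"
        by (auto simp: pauli_group_eq)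
      then have "weyl v \<in> \<Union>\<L>"
        using C self_mem_cls by blast
      then have "v \<in> eigendirs ?\<psi>"
        using eig unfolding eigendirs_def by blast
      with v show "C \<in> (\<lambda>v. cls (weyl v)) ` eigendirs ?\<psi>" by blast
    qed
    then have "card \<L> \<le> card (eigendirs ?\<psi>)"
      by (intro surj_card_le) simp
    then show "x \<in> {x. CARD('p) ^ CARD('n) \<le> card (eigendirs (unit_rep x))}"
      using L by (simp add: maximal_isotropic_def)
  }
  assume "x \<in> {x. CARD('p) ^ CARD('n) \<le> card (eigendirs (unit_rep x))}"
  then have card: "card (eigendirs ?\<psi>) = CARD('p) ^ CARD('n)"
    using isotropic_card_le[OF phase_subspace_eigendirs isotropic_eigendirs[OF unit_rep_nonzero], of x]
    by simp
  note sub = phase_subspace_eigendirs[of ?\<psi>]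
  define \<L> where "\<L> = (\<lambda>v. cls (weyl v)) ` eigendirs ?\<psi>"
  have "inj_on (\<lambda>v. cls (weyl v)) (eigendirs ?\<psi>)"
    by (rule inj_onI) (metis cls_eq_iff weyl_inject)
  then have cardL: "card \<L> = CARD('p) ^ CARD('n)"
    by (simp add: \<L>_def card_image card)
  have mem: "\<exists>c v. cmod c = 1 \<and> v \<in> eigendirs ?\<psi> \<and> A = mat c ** weyl v" if "A \<in> \<Union>\<L>" for A
    using that by (auto simp: \<L>_def mem_cls)
  have subgroup: "subgroup \<L> PU"
  proof (rule group.subgroupI[OF group_PU])
    show "\<L> \<subseteq> carrier PU"
      by (auto simp: \<L>_def carrier_PU weyl_unitary)
    show "\<L> \<noteq> {}"
      using zero_eigendirs by (auto simp: \<L>_def)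
  next
    fix C assume "C \<in> \<L>"
    then obtain v where v: "v \<in> eigendirs ?\<psi>" "C = cls (weyl v)" by (auto simp: \<L>_def)
    have "cls (adj (weyl v)) = cls (weyl (- v))"
      unfolding cls_eq_iff adj_weyl using norm_chi by blast
    with v phase_subspace_uminus[OF sub] show "inv\<^bsub>PU\<^esub> C \<in> \<L>"
      by (auto simp: PU_inv weyl_unitary \<L>_def)
  next
    fix C D assume "C \<in> \<L>" "D \<in> \<L>"
    then obtain v w where vw: "v \<in> eigendirs ?\<psi>" "C = cls (weyl v)" "w \<in> eigendirs ?\<psi>" "D = cls (weyl w)"
      by (auto simp: \<L>_def)
    have "cls (weyl v ** weyl w) = cls (weyl (v + w))"
      unfolding cls_eq_iff by (rule weyl_ex_mult)
    moreover have "v + w \<in> eigendirs ?\<psi>"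
      using vw by (simp add: eigendirs_add)
    ultimately show "C \<otimes>\<^bsub>PU\<^esub> D \<in> \<L>"
      unfolding vw \<L>_def by (simp add: PU_mult weyl_unitary)
  qed
  have "A ** B = B ** A" if AB: "A \<in> \<Union>\<L>" "B \<in> \<Union>\<L>" for A B
  proof -
    obtain a v where a: "v \<in> eigendirs ?\<psi>" "A = mat a ** weyl v" using mem[OF AB(1)] by blast
    obtain b w where b: "w \<in> eigendirs ?\<psi>" "B = mat b ** weyl w" using mem[OF AB(2)] by blast
    have "weyl v ** weyl w = weyl w ** weyl v"
      using symp_eigendirs[OF a(1) b(1) unit_rep_nonzero] by (simp add: weyl_commute[of v w])
    then show ?thesis
      by (simp add: a b mat_left_commute[of "weyl _"] mat_simps mult.commute)
  qed
  with subgroup cardL have L: "maximal_isotropic \<L>"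
    unfolding maximal_isotropic_def by (auto simp: \<L>_def pauli_group_eq)
  \<comment> \<open>On \<open>\<Union>\<L>\<close> such a \<open>c\<close> exists, and it is unique
    because \<open>?\<psi>\<close> is nonzero; uniqueness yields multiplicativity.\<close>
  define \<kappa> where "\<kappa> A = (SOME c. A *v ?\<psi> = c *s ?\<psi>)" for A
  have \<kappa>: "A *v ?\<psi> = \<kappa> A *s ?\<psi>" if A: "A \<in> \<Union>\<L>" for A
  proof -
    obtain c v e where "A = mat c ** weyl v" "weyl v *v ?\<psi> = e *s ?\<psi>"
      using mem[OF A] unfolding eigendirs_def by blast
    then have "A *v ?\<psi> = (c * e) *s ?\<psi>"
      by (simp add: matrix_vector_mul_assoc[symmetric] mat_vec vector_smult_assoc)
    then show ?thesis
      unfolding \<kappa>_def by (rule someI)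
  qed
  have \<kappa>_mult: "\<kappa> (A ** B) = \<kappa> A * \<kappa> B" if "A \<in> \<Union>\<L>" "B \<in> \<Union>\<L>" for A B
  proof -
    have e: "(A ** B) *v ?\<psi> = (\<kappa> A * \<kappa> B) *s ?\<psi>"
      by (simp add: matrix_vector_mul_assoc[symmetric] \<kappa>[OF that(1)] \<kappa>[OF that(2)] matrix_vector_mult_smult
          vector_smult_assoc mult.commute)
    then have "(A ** B) *v ?\<psi> = \<kappa> (A ** B) *s ?\<psi>"
      unfolding \<kappa>_def by (rule someI)
    with e show ?thesis
      using unit_rep_nonzero[of x] by (simp add: vector_mul_rcancel)
  qed
  have "Rep_cproj x = {\<phi>. \<forall>A\<in>\<Union>\<L>. A *v \<phi> = \<kappa> A *s \<phi>}"
  proof (intro Set.set_eqI iffI)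
    fix \<phi> assume "\<phi> \<in> Rep_cproj x"
    then obtain c where c: "\<phi> = c *s ?\<psi>" by (auto simp: Rep)
    have "A *v \<phi> = \<kappa> A *s \<phi>" if "A \<in> \<Union>\<L>" for A
      unfolding c matrix_vector_mult_smult \<kappa>[OF that] by (simp add: vector_smult_assoc mult.commute)
    then show "\<phi> \<in> {\<phi>. \<forall>A\<in>\<Union>\<L>. A *v \<phi> = \<kappa> A *s \<phi>}"
      by blast
  next
    fix \<phi> assume "\<phi> \<in> {\<phi>. \<forall>A\<in>\<Union>\<L>. A *v \<phi> = \<kappa> A *s \<phi>}"
    moreover have "weyl v \<in> \<Union>\<L>" if "v \<in> eigendirs ?\<psi>" for v
      using that self_mem_cls by (auto simp: \<L>_def)
    ultimately have "\<exists>a. \<phi> = a *s ?\<psi>"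
      using \<kappa> by (intro joint_eigenvector_unique[OF unit_rep_nonzero card, of "\<lambda>v. \<kappa> (weyl v)"]) blast+
    then show "\<phi> \<in> Rep_cproj x" by (auto simp: Rep)
  qed
  with L \<kappa>_mult show "x \<in> stabilizer_states"
    unfolding stabilizer_states_def by blast
qed

section \<open>Eigendirections after a measurement\<close>

lemma site_proj_nth: "site_proj j0 m $ s $ t = (if s = t \<and> s j0 = m then 1 else 0)"
proof (cases "s = t \<and> s j0 = m")
  case True
  then show ?thesis
    by (auto simp: site_proj_def tensor_def mat_def intro!: prod.neutral)
next
  case False
  then obtain k where "k = j0 \<and> s j0 \<noteq> m \<or> s k \<noteq> t k"
    by (auto simp: fun_eq_iff)
  then have "(if k = j0 then (\<chi> a b. if a = m \<and> b = m then 1 else 0) else mat 1) $ s k $ t k = (0 :: complex)"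
    by (auto simp: mat_def)
  then have "(\<Prod>k\<in>UNIV. (if k = j0 then (\<chi> a b. if a = m \<and> b = m then 1 else 0) else mat 1) $ s k $ t k) = (0 :: complex)"
    by (intro prod_zero bexI[of _ k]) (assumption | rule finite UNIV_I)+
  with False show ?thesis
    by (auto simp: site_proj_def tensor_def)
qed

lemma site_proj_mult_left: "(site_proj j0 m ** M) $ s $ t = (if s j0 = m then M $ s $ t else 0)"
proof -
  have "(site_proj j0 m ** M) $ s $ t = (\<Sum>u\<in>UNIV. if u = s then (if s j0 = m then M $ s $ t else 0) else 0)"
    unfolding matrix_matrix_mult_def vec_lambda_beta by (rule sum.cong) (auto simp: site_proj_nth)
  then show ?thesis by simp
qed

lemma site_proj_mult_right: "(M ** site_proj j0 m) $ s $ t = (if t j0 = m then M $ s $ t else 0)"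
proof -
  have "(M ** site_proj j0 m) $ s $ t = (\<Sum>u\<in>UNIV. if u = t then (if t j0 = m then M $ s $ t else 0) else 0)"
    unfolding matrix_matrix_mult_def vec_lambda_beta by (rule sum.cong) (auto simp: site_proj_nth)
  then show ?thesis by simp
qed

lemma site_proj_mult_vec: "(site_proj j0 m *v \<psi>) $ s = (if s j0 = m then \<psi> $ s else 0)"
proof -
  have "(site_proj j0 m *v \<psi>) $ s = (\<Sum>u\<in>UNIV. if u = s then (if s j0 = m then \<psi> $ s else 0) else 0)"
    unfolding matrix_vector_mult_def vec_lambda_beta by (rule sum.cong) (auto simp: site_proj_nth)
  then show ?thesis by simp
qed

text \<open>The label of the operator Z at site \<open>j0\<close>, whose eigenprojections are the
  \<open>site_proj j0 m\<close>.\<close>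

definition zdir :: "'n::finite \<Rightarrow> ('n, 'p::prime_card) phase_space" where
  "zdir j0 = (\<lambda>k. if k = j0 then 1 else 0, 0)"

lemma zdir_nonzero: "zdir j0 \<noteq> 0"
  by (auto simp: zdir_def prod_eq_iff fun_eq_iff)

lemma sum_zdir: "(\<Sum>k\<in>UNIV. fst (zdir j0) k * s k) = s j0"
  by (simp add: zdir_def if_distrib[of "\<lambda>x. x * _"] cong: if_cong)

lemma weyl_zdir_nth: "weyl (zdir j0) $ s $ t = (if s = t then chi (s j0) else 0)"
  unfolding weyl_nth sum_zdir by (simp add: zdir_def)

lemma weyl_zdir_mult_left: "(weyl (zdir j0) ** M) $ s $ t = chi (s j0) * M $ s $ t"
proof -
  have "(weyl (zdir j0) ** M) $ s $ t = (\<Sum>u\<in>UNIV. if u = s then chi (s j0) * M $ s $ t else 0)"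
    unfolding matrix_matrix_mult_def vec_lambda_beta by (rule sum.cong) (auto simp: weyl_zdir_nth)
  then show ?thesis by simp
qed

lemma weyl_zdir_mult_right: "(M ** weyl (zdir j0)) $ s $ t = chi (t j0) * M $ s $ t"
proof -
  have "(M ** weyl (zdir j0)) $ s $ t = (\<Sum>u\<in>UNIV. if u = t then chi (t j0) * M $ s $ t else 0)"
    unfolding matrix_matrix_mult_def vec_lambda_beta by (rule sum.cong) (auto simp: weyl_zdir_nth)
  then show ?thesis by simp
qed

lemma weyl_zdir_site_proj: "weyl (zdir j0) ** site_proj j0 m = mat (chi m) ** site_proj j0 m"
  by (auto simp: vec_eq_iff weyl_zdir_mult_left mat_mult_nth site_proj_nth)

text \<open>The eigenvalues of \<open>Z\<close> at site \<open>j0\<close> are distinct, so its commutant preserves the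
  eigenspaces.\<close>

lemma site_proj_commute:
  assumes "M ** weyl (zdir j0) = weyl (zdir j0) ** M"
  shows "M ** site_proj j0 m = site_proj j0 m ** M"
proof -
  have "M $ s $ t = 0" if "s j0 \<noteq> t j0" for s t
  proof -
    have "(M ** weyl (zdir j0)) $ s $ t = (weyl (zdir j0) ** M) $ s $ t"
      using assms by simp
    with that show ?thesis
      by (simp add: weyl_zdir_mult_left weyl_zdir_mult_right chi_inject)
  qed
  then show ?thesis
    by (auto simp: vec_eq_iff site_proj_mult_left site_proj_mult_right)
qed

section \<open>Effect of one measurement outcome on the eigendirections\<close>

context
  fixes U :: "('n::finite \<Rightarrow> 'p::prime_card mod_ring) op" and j0 m \<psi> \<phi> w \<beta>
  assumes U: "unitary U" and \<beta>: "cmod \<beta> = 1"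
    and w: "weyl (zdir j0) ** U = mat \<beta> ** (U ** weyl w)"
    and \<phi>: "\<phi> = adj U *v (site_proj j0 m *v (U *v \<psi>))"
begin

text \<open>\<open>weyl w\<close> is, up to phase, Z at \<open>j0\<close> conjugated by
  \<open>U\<close>, and \<open>\<phi>\<close> lies in one of its eigenspaces.\<close>

lemma measured_eigendir: "w \<in> eigendirs \<phi>"
proof -
  have "weyl w ** adj U = mat (cnj \<beta>) ** (adj U ** (weyl (zdir j0) ** U) ** adj U)"
    unfolding w using U
    by (simp add: mat_left_commute[of "adj U"] mat_simps cnj_mult_self[OF \<beta>]
        matrix_mul_assoc[symmetric] unitary_cancel)
  also have "\<dots> = mat (cnj \<beta>) ** (adj U ** weyl (zdir j0))"
    using U by (simp add: matrix_mul_assoc[symmetric] unitaryD)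
  finally have "weyl w ** adj U ** site_proj j0 m = mat (cnj \<beta>) ** (adj U ** (weyl (zdir j0) ** site_proj j0 m))"
    by (simp add: matrix_mul_assoc[symmetric])
  then have "weyl w ** adj U ** site_proj j0 m = mat (cnj \<beta> * chi m) ** (adj U ** site_proj j0 m)"
    by (simp add: weyl_zdir_site_proj mat_left_commute[of "adj U"] mat_simps)
  then have "(weyl w ** adj U ** site_proj j0 m) *v (U *v \<psi>) =
      (mat (cnj \<beta> * chi m) ** (adj U ** site_proj j0 m)) *v (U *v \<psi>)" by simp
  then have "weyl w *v \<phi> = (cnj \<beta> * chi m) *s \<phi>"
    by (simp only: \<phi> matrix_vector_mul_assoc[symmetric] mat_vec)
  then show ?thesis
    unfolding eigendirs_def by blast
qed

text \<open>Conjugated by \<open>U\<close>, \<open>weyl s\<close> commutes with Z at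
  \<open>j0\<close>, hence with its spectral projections. So \<open>weyl s\<close> passes through
  the measurement and \<open>\<phi>\<close> inherits the eigenvalue of
  \<open>\<psi>\<close>.\<close>

lemma commuting_eigendir:
  assumes s: "s \<in> eigendirs \<psi>" "symp s w = 0"
  shows "s \<in> eigendirs \<phi>"
proof -
  let ?M = "U ** weyl s ** adj U"
  obtain c where c: "weyl s *v \<psi> = c *s \<psi>"
    using s(1) by (auto simp: eigendirs_def)
  have sw: "weyl s ** weyl w = weyl w ** weyl s"
    by (simp add: weyl_commute[of s w] s(2))
  have Z: "weyl (zdir j0) = mat \<beta> ** (U ** weyl w ** adj U)"
  proof -
    have "weyl (zdir j0) = weyl (zdir j0) ** U ** adj U"
      using U by (simp add: matrix_mul_assoc[symmetric] unitaryD)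
    then show ?thesis
      unfolding w by (simp add: matrix_mul_assoc)
  qed
  have "?M ** weyl (zdir j0) = mat \<beta> ** (U ** (weyl s ** weyl w) ** adj U)"
    unfolding Z mat_left_commute[of "?M"]
    using U by (simp add: matrix_mul_assoc[symmetric] unitary_cancel)
  also have "\<dots> = weyl (zdir j0) ** ?M"
    unfolding Z sw mat_mult_assoc
    using U by (simp add: matrix_mul_assoc[symmetric] unitary_cancel)
  finally have comm: "?M ** site_proj j0 m = site_proj j0 m ** ?M"
    by (rule site_proj_commute)
  have "weyl s ** (adj U ** site_proj j0 m ** U) = adj U ** (?M ** site_proj j0 m) ** U"
    using U by (simp add: matrix_mul_assoc[symmetric] unitary_cancel)
  also have "\<dots> = (adj U ** site_proj j0 m ** U) ** weyl s"
    unfolding comm using U by (simp add: matrix_mul_assoc[symmetric] unitaryD)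
  finally have "(weyl s ** (adj U ** site_proj j0 m ** U)) *v \<psi> =
      ((adj U ** site_proj j0 m ** U) ** weyl s) *v \<psi>" by simp
  then have "weyl s *v \<phi> = c *s \<phi>"
    by (simp add: \<phi> matrix_vector_mul_assoc[symmetric] c matrix_vector_mult_smult)
  then show ?thesis
    unfolding eigendirs_def by blast
qed

lemma card_eigendirs_strict:
  assumes "w \<in> perp (eigendirs \<psi>)" "w \<notin> eigendirs \<psi>"
  shows "card (eigendirs \<psi>) < card (eigendirs \<phi>)"
proof -
  have "eigendirs \<psi> \<subset> eigendirs \<phi>"
    using commuting_eigendir measured_eigendir assms by (auto simp: perp_def)
  then show ?thesis
    by (intro psubset_card_mono) auto
qed

lemma card_eigendirs_mono:
  assumes "\<psi> \<noteq> 0"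
  shows "card (eigendirs \<psi>) \<le> card (eigendirs \<phi>)"
proof (cases "w \<in> perp (eigendirs \<psi>)")
  case True
  then have "eigendirs \<psi> \<subseteq> eigendirs \<phi>"
    using commuting_eigendir by (auto simp: perp_def)
  then show ?thesis
    by (intro card_mono) auto
next
  case False
  then obtain s0 where s0: "s0 \<in> eigendirs \<psi>" "symp s0 w \<noteq> 0"
    unfolding perp_def by blast
  \<comment> \<open>The directions orthogonal to \<open>w\<close> have index \<open>d\<close>, and adjoining \<open>w\<close> regains the factor \<open>d\<close>.\<close>
  let ?T = "{s \<in> eigendirs \<psi>. symp s w = 0}"
  note sub = phase_subspace_eigendirs[of \<psi>] phase_subspace_eigendirs[of \<phi>]
  \<comment> \<open>Splits \<open>s\<close> into a multiple of \<open>s0\<close> and a remainder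
    orthogonal to \<open>w\<close>; injectivity bounds the old count by d times the size of
    \<open>?T\<close>.\<close>
  define f where "f s = (symp s w / symp s0 w, s - scal (symp s w / symp s0 w) s0)" for s
  have "inj f"
    by (rule injI) (auto simp: f_def)
  moreover have "f ` eigendirs \<psi> \<subseteq> UNIV \<times> ?T"
  proof
    fix y assume "y \<in> f ` eigendirs \<psi>"
    then obtain s where s: "s \<in> eigendirs \<psi>" "y = f s" by blast
    have "scal (symp s w / symp s0 w) s0 \<in> eigendirs \<psi>"
      using sub(1) s0(1) by (simp add: phase_subspace_def)
    then have "s - scal (symp s w / symp s0 w) s0 \<in> eigendirs \<psi>"
      using eigendirs_add[OF s(1) phase_subspace_uminus[OF sub(1)]] by simp
    moreover have "symp (s - scal (symp s w / symp s0 w) s0) w = 0"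
      using s0(2) by (simp add: symp_diff_left symp_scal_left)
    ultimately show "y \<in> UNIV \<times> ?T"
      by (simp add: s f_def)
  qed
  ultimately have "card (eigendirs \<psi>) \<le> card (UNIV \<times> ?T :: ('p mod_ring \<times> _) set)"
    by (intro card_inj_on_le[of f]) (auto intro: inj_on_subset)
  also have "\<dots> \<le> card (eigendirs \<phi>)"
  proof (rule card_inj_on_le)
    show "(\<lambda>(k, t). t + scal k w) ` (UNIV \<times> ?T) \<subseteq> eigendirs \<phi>"
      using sub(2) commuting_eigendir measured_eigendir by (auto simp: phase_subspace_def)
    show "inj_on (\<lambda>(k, t). t + scal k w) (UNIV \<times> ?T)"
    proof (rule inj_onI, clarify)
      fix k l t u
      assume t: "t \<in> eigendirs \<psi>" "u \<in> eigendirs \<psi>" and eq: "t + scal k w = u + scal l w"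
      \<comment> \<open>Pairing with \<open>s0\<close> kills \<open>t\<close> and \<open>u\<close>,
        which are old eigendirections like \<open>s0\<close>, and so reads off the coefficient of
        \<open>w\<close>.\<close>
      have "symp s0 (t + scal k w) = symp s0 (u + scal l w)"
        using eq by simp
      then have "k = l"
        using s0(2) symp_eigendirs[OF s0(1) t(1) assms] symp_eigendirs[OF s0(1) t(2) assms]
        by (simp add: symp_add_right symp_scal_right)
      with eq show "k = l \<and> t = u" by simp
    qed
  qed simp
  finally show ?thesis .
qed

end

lemma clifford_op_measured_direction:
  assumes U: "clifford_op U"
  obtains w \<beta> where "cmod \<beta> = 1" "weyl v ** U = mat \<beta> ** (U ** weyl w)"
proof -
  obtain w \<beta> where w: "cmod \<beta> = 1" "adj U ** weyl v ** U = mat \<beta> ** weyl w"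
    using U unfolding clifford_op_def is_weyl_def by blast
  have "weyl v ** U = U ** (adj U ** weyl v ** U)"
    using clifford_op_unitary[OF U] by (simp add: matrix_mul_assoc[symmetric] unitary_cancel)
  then have "weyl v ** U = mat \<beta> ** (U ** weyl w)"
    unfolding w mat_left_commute[of U] .
  with w(1) that show thesis by blast
qed

section \<open>Borel sets of rays\<close>

text \<open>Vanishing 2 by 2 minors express proportionality without naming an eigenvalue; they are
  continuous in \<open>\<psi>\<close>, so the condition is closed.\<close>

lemma eigendirs_iff_minors:
  assumes "\<psi> \<noteq> 0"
  shows "v \<in> eigendirs \<psi> \<longleftrightarrow> (\<forall>s t. \<psi> $ s * (weyl v *v \<psi>) $ t = \<psi> $ t * (weyl v *v \<psi>) $ s)"
proof
  assume "v \<in> eigendirs \<psi>"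
  then show "\<forall>s t. \<psi> $ s * (weyl v *v \<psi>) $ t = \<psi> $ t * (weyl v *v \<psi>) $ s"
    by (auto simp: eigendirs_def)
next
  assume *: "\<forall>s t. \<psi> $ s * (weyl v *v \<psi>) $ t = \<psi> $ t * (weyl v *v \<psi>) $ s"
  obtain s where s: "\<psi> $ s \<noteq> 0"
    using assms by (auto simp: vec_eq_iff)
  have "weyl v *v \<psi> = ((weyl v *v \<psi>) $ s / \<psi> $ s) *s \<psi>"
    using * s by (simp add: vec_eq_iff field_simps)
  then show "v \<in> eigendirs \<psi>"
    unfolding eigendirs_def by blast
qed

lemma closed_eigendir: "closed {x. v \<in> eigendirs (unit_rep x)}"
proof -
  have "{\<psi>. \<psi> \<noteq> 0 \<and> ray \<psi> \<in> - {x. v \<in> eigendirs (unit_rep x)}} =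
      - {0} \<inter> (\<Union>s. \<Union>t. {\<psi>. \<psi> $ s * (weyl v *v \<psi>) $ t \<noteq> \<psi> $ t * (weyl v *v \<psi>) $ s})"
    by (auto simp: eigendirs_unit_rep eigendirs_iff_minors)
  moreover have "open (- {0} \<inter> (\<Union>s. \<Union>t. {\<psi>. \<psi> $ s * (weyl v *v \<psi>) $ t \<noteq> \<psi> $ t * (weyl v *v \<psi>) $ s}))"
    unfolding weyl_mult_vec
    by (intro open_Int open_UN ballI open_Collect_neq continuous_intros)
  ultimately show ?thesis
    by (simp add: closed_def open_cproj_def)
qed

text \<open>A superlevel set is a finite union, over the sets \<open>T\<close> of at least
  \<open>k\<close> directions, of the closed conditions that all of \<open>T\<close> are
  eigendirections.\<close>

lemma borel_card_eigendirs:
  "{x. k \<le> card (eigendirs (unit_rep x))} \<in> sets (borel :: ('n::finite \<Rightarrow> 'p::prime_card mod_ring) cproj measure)"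
proof -
  have "{x. k \<le> card (eigendirs (unit_rep x))} =
      (\<Union>T\<in>{T :: ('n, 'p) phase_space set. k \<le> card T}. \<Inter>v\<in>T. {x. v \<in> eigendirs (unit_rep x)})"
  proof (intro Set.set_eqI iffI)
    fix x
    assume "x \<in> (\<Union>T\<in>{T :: ('n, 'p) phase_space set. k \<le> card T}. \<Inter>v\<in>T. {x. v \<in> eigendirs (unit_rep x)})"
    then obtain T where T: "k \<le> card T" "T \<subseteq> eigendirs (unit_rep x)" by auto
    then show "x \<in> {x. k \<le> card (eigendirs (unit_rep x))}"
      using card_mono[OF _ T(2)] by simp
  qed auto
  moreover have "closed (\<Union>T\<in>{T :: ('n, 'p) phase_space set. k \<le> card T}. \<Inter>v\<in>T. {x. v \<in> eigendirs (unit_rep x)})"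
    by (intro closed_UN closed_INT ballI closed_eigendir) simp
  ultimately show ?thesis
    by (simp add: borel_closed)
qed

section \<open>The reference kernel\<close>

definition level :: "('n::finite \<Rightarrow> 'p::prime_card mod_ring) cproj \<Rightarrow> nat" where
  "level x = card (eigendirs (unit_rep x))"

lemma level_ray: "\<psi> \<noteq> 0 \<Longrightarrow> level (ray \<psi>) = card (eigendirs \<psi>)"
  by (simp add: level_def eigendirs_unit_rep)

lemma sum_norm_site_proj:
  fixes \<phi> :: "complex ^ ('n::finite \<Rightarrow> 'p::prime_card mod_ring)"
  shows "(\<Sum>m\<in>UNIV. (norm (site_proj j0 m *v \<phi>))\<^sup>2) = (norm \<phi>)\<^sup>2"
proof -
  have n: "(norm \<psi>)\<^sup>2 = (\<Sum>s\<in>UNIV. (cmod (\<psi> $ s))\<^sup>2)" for \<psi> :: "complex ^ ('n \<Rightarrow> 'p mod_ring)"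
    by (simp add: norm_vec_def L2_set_def sum_nonneg)
  have "(\<Sum>m\<in>UNIV. (norm (site_proj j0 m *v \<phi>))\<^sup>2) =
      (\<Sum>s\<in>UNIV. \<Sum>m\<in>UNIV. if m = s j0 then (cmod (\<phi> $ s))\<^sup>2 else 0)"
    unfolding n by (subst sum.swap) (auto simp: site_proj_mult_vec intro!: sum.cong)
  then show ?thesis
    by (simp add: n)
qed

context
  fixes j0 :: "'n::finite"
    and x :: "('n \<Rightarrow> 'p::prime_card mod_ring) cproj"
begin

definition outcomes :: "('n \<Rightarrow> 'p mod_ring) op set \<Rightarrow> 'p mod_ring set" where
  "outcomes C = {m. site_proj j0 m *v (unitary_rep C *v unit_rep x) \<noteq> 0}"

definition weight :: "('n \<Rightarrow> 'p mod_ring) op set \<Rightarrow> 'p mod_ring \<Rightarrow> real" where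
  "weight C m = (norm (site_proj j0 m *v (unitary_rep C *v unit_rep x)))\<^sup>2"

definition post :: "('n \<Rightarrow> 'p mod_ring) op set \<Rightarrow> 'p mod_ring \<Rightarrow> complex ^ ('n \<Rightarrow> 'p mod_ring)" where
  "post C m = adj (unitary_rep C) *v (site_proj j0 m *v (unitary_rep C *v unit_rep x))"

lemma ref_kernel_value_eq:
  assumes "A \<in> sets borel"
  shows "ref_kernel_value j0 x A =
    ennreal (1 / card (clifford_group :: ('n \<Rightarrow> 'p mod_ring) op set set)) *
    (\<Sum>C\<in>clifford_group. \<Sum>m\<in>outcomes C. ennreal (weight C m) * indicator A (ray (post C m)))"
  unfolding ref_kernel_value_def Let_def outcomes_def weight_def post_def
  using assms by simp

lemma sum_weight:
  assumes "C \<in> clifford_group"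
  shows "(\<Sum>m\<in>outcomes C. ennreal (weight C m)) = 1"
proof -
  have "unitary (unitary_rep C)"
    using assms clifford_op_unitary_rep clifford_op_unitary by blast
  then have "(\<Sum>m\<in>UNIV. weight C m) = 1"
    unfolding weight_def sum_norm_site_proj by (simp add: norm_unitary unit_rep)
  moreover have "(\<Sum>m\<in>outcomes C. weight C m) = (\<Sum>m\<in>UNIV. weight C m)"
    by (rule sum.mono_neutral_left) (auto simp: outcomes_def weight_def)
  ultimately show ?thesis
    by (subst sum_ennreal) (auto simp: weight_def)
qed

lemma post_nonzero:
  assumes "C \<in> clifford_group" "m \<in> outcomes C"
  shows "post C m \<noteq> 0"
proof -
  have "unitary (adj (unitary_rep C))"
    using assms(1) clifford_op_unitary_rep clifford_op_unitary unitary_adj by blast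
  then have "norm (post C m) = norm (site_proj j0 m *v (unitary_rep C *v unit_rep x))"
    unfolding post_def by (rule norm_unitary)
  with assms(2) show ?thesis
    by (auto simp: outcomes_def)
qed

lemma level_post_mono:
  assumes "C \<in> clifford_group" "m \<in> outcomes C"
  shows "level x \<le> level (ray (post C m))"
proof -
  have U: "clifford_op (unitary_rep C)"
    by (rule clifford_op_unitary_rep[OF assms(1)])
  obtain w \<beta> where "cmod \<beta> = 1" "weyl (zdir j0) ** unitary_rep C = mat \<beta> ** (unitary_rep C ** weyl w)"
    using clifford_op_measured_direction[OF U] .
  then show ?thesis
    using card_eigendirs_mono[OF clifford_op_unitary[OF U] _ _ post_def unit_rep_nonzero]
    by (simp add: level_ray[OF post_nonzero[OF assms]]) (simp add: level_def)
qed

text \<open>The class is chosen so that the direction it measures is a new one commuting with all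
  old ones. Every outcome then raises the level, however small its probability.\<close>

lemma level_post_strict:
  assumes "level x < CARD('p) ^ CARD('n)"
  obtains C where "C \<in> clifford_group" "\<And>m. m \<in> outcomes C \<Longrightarrow> level x < level (ray (post C m))"
proof -
  obtain w where w: "w \<in> perp (eigendirs (unit_rep x))" "w \<notin> eigendirs (unit_rep x)"
    using isotropic_extendable[OF phase_subspace_eigendirs] assms unfolding level_def by blast
  then have "w \<noteq> 0"
    using zero_eigendirs by metis
  then obtain U \<beta> where U: "clifford_op U" "cmod \<beta> = 1" "weyl (zdir j0) ** U = mat \<beta> ** (U ** weyl w)"
    using clifford_transitive[OF zdir_nonzero] by blast
  define C where "C = cls U"
  have C: "C \<in> clifford_group"
    using U by (simp add: C_def clifford_group_eq)
  obtain c where c: "unitary_rep C = mat c ** U"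
    using unitary_rep_cls unfolding C_def by blast
  \<comment> \<open>The chosen representative differs from \<open>U\<close> by a phase, which
    appears on both sides.\<close>
  have rep: "weyl (zdir j0) ** unitary_rep C = mat \<beta> ** (unitary_rep C ** weyl w)"
    unfolding c mat_left_commute[of "weyl _"] U by (simp add: mat_simps mult.commute)
  show thesis
  proof (rule that[OF C])
    fix m assume m: "m \<in> outcomes C"
    show "level x < level (ray (post C m))"
      using card_eigendirs_strict[OF clifford_op_unitary[OF clifford_op_unitary_rep[OF C]] U(2) rep post_def w]
      by (simp add: level_ray[OF post_nonzero[OF C m]]) (simp add: level_def)
  qed
qed

end

section \<open>Upward drift of the level under the kernel and invariant measures\<close>

lemma level_borel:
  "{x. k \<le> level x} \<in> sets (borel :: ('n::finite \<Rightarrow> 'p::prime_card mod_ring) cproj measure)"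
  unfolding level_def by (rule borel_card_eigendirs)

lemma kernel_level_absorbing:
  fixes x :: "('n::finite \<Rightarrow> 'p::prime_card mod_ring) cproj"
  assumes card: "card (clifford_group :: ('n \<Rightarrow> 'p mod_ring) op set set) > 0" and k: "k \<le> level x"
  shows "emeasure (ref_kernel j0 x) {y. k \<le> level y} = 1"
proof -
  let ?CG = "clifford_group :: ('n \<Rightarrow> 'p mod_ring) op set set"
  have "(\<Sum>C\<in>?CG. \<Sum>m\<in>outcomes j0 x C.
      ennreal (weight j0 x C m) * indicator {y. k \<le> level y} (ray (post j0 x C m))) = (\<Sum>C\<in>?CG. 1)"
  proof (rule sum.cong[OF refl])
    fix C assume C: "C \<in> ?CG"
    have "(\<Sum>m\<in>outcomes j0 x C. ennreal (weight j0 x C m) * indicator {y. k \<le> level y} (ray (post j0 x C m))) =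
        (\<Sum>m\<in>outcomes j0 x C. ennreal (weight j0 x C m))"
      using level_post_mono[OF C] k by (intro sum.cong) (auto simp: indicator_def intro: order_trans)
    then show "(\<Sum>m\<in>outcomes j0 x C. ennreal (weight j0 x C m) * indicator {y. k \<le> level y} (ray (post j0 x C m))) = 1"
      by (simp add: sum_weight[OF C])
  qed
  then show ?thesis
    using card
    by (simp add: emeasure_ref_kernel level_borel ref_kernel_value_eq ennreal_of_nat_eq_real_of_nat
        ennreal_mult[symmetric])
qed

text \<open>A single class whose outcomes all raise the level contributes total weight 1 to the
  average. The bound is therefore the same for all states.\<close>

lemma kernel_level_increase:
  fixes x :: "('n::finite \<Rightarrow> 'p::prime_card mod_ring) cproj"
  assumes card: "card (clifford_group :: ('n \<Rightarrow> 'p mod_ring) op set set) > 0"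
    and k: "level x < CARD('p) ^ CARD('n)"
  shows "ennreal (1 / card (clifford_group :: ('n \<Rightarrow> 'p mod_ring) op set set)) \<le>
    emeasure (ref_kernel j0 x) {y. Suc (level x) \<le> level y}"
proof -
  let ?CG = "clifford_group :: ('n \<Rightarrow> 'p mod_ring) op set set"
  let ?f = "\<lambda>C. \<Sum>m\<in>outcomes j0 x C.
      ennreal (weight j0 x C m) * indicator {y. Suc (level x) \<le> level y} (ray (post j0 x C m))"
  obtain C where C: "C \<in> ?CG" "\<And>m. m \<in> outcomes j0 x C \<Longrightarrow> level x < level (ray (post j0 x C m))"
    using level_post_strict[OF k] by blast
  have "finite ?CG"
    using card by (simp add: card_gt_0_iff)
  have "1 = (\<Sum>m\<in>outcomes j0 x C. ennreal (weight j0 x C m))"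
    by (simp add: sum_weight[OF C(1)])
  also have "\<dots> = ?f C"
    using C(2) by (intro sum.cong) (auto simp: indicator_def Suc_le_eq)
  also have "\<dots> \<le> (\<Sum>C\<in>?CG. ?f C)"
    using C(1) \<open>finite ?CG\<close> by (intro member_le_sum) auto
  finally have "ennreal (1 / card ?CG) * 1 \<le> ennreal (1 / card ?CG) * (\<Sum>C\<in>?CG. ?f C)"
    by (rule mult_left_mono) simp
  then show ?thesis
    by (simp add: emeasure_ref_kernel level_borel ref_kernel_value_eq)
qed

text \<open>For an infinite Clifford group the factor \<open>1 / card\<close> would be the junk value \<open>0\<close> and the kernel
  would vanish; so the mere existence of an invariant probability supplies finiteness.\<close>

lemma invariant_prob_card_clifford:
  fixes \<pi> :: "('n::finite \<Rightarrow> 'p::prime_card mod_ring) cproj measure"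
  assumes "invariant_prob (ref_kernel j0) \<pi>"
  shows "card (clifford_group :: ('n \<Rightarrow> 'p mod_ring) op set set) > 0"
proof (rule ccontr)
  assume "\<not> card (clifford_group :: ('n \<Rightarrow> 'p mod_ring) op set set) > 0"
  then have "emeasure (ref_kernel j0 x) UNIV = 0" for x :: "('n \<Rightarrow> 'p mod_ring) cproj"
    by (simp add: emeasure_ref_kernel ref_kernel_value_def)
  moreover have "emeasure \<pi> UNIV = (\<integral>\<^sup>+ x. emeasure (ref_kernel j0 x) UNIV \<partial>\<pi>)"
    using assms by (simp add: invariant_prob_def)
  moreover have "emeasure \<pi> UNIV = 1"
    using assms prob_space.emeasure_space_1[of \<pi>] sets_eq_imp_space_eq[of \<pi> borel]
    by (simp add: invariant_prob_def)
  ultimately show False by simp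
qed

text \<open>The kernel mass of \<open>?A\<close> dominates
  \<open>indicator ?A + ?c * indicator ?B\<close>. Integrating against the invariant measure returns
  the mass of \<open>?A\<close> itself, so \<open>?B\<close>, the states of level exactly
  \<open>k\<close>, must be null.\<close>

lemma invariant_prob_level:
  fixes \<pi> :: "('n::finite \<Rightarrow> 'p::prime_card mod_ring) cproj measure"
  assumes inv: "invariant_prob (ref_kernel j0) \<pi>" and "k \<le> CARD('p) ^ CARD('n)"
  shows "emeasure \<pi> {x. k \<le> level x} = 1"
  using assms(2)
proof (induction k)
  case 0
  show ?case
    using inv prob_space.emeasure_space_1[of \<pi>] sets_eq_imp_space_eq[of \<pi> borel]
    by (simp add: invariant_prob_def)
next
  case (Suc k)
  let ?A = "{x :: ('n \<Rightarrow> 'p mod_ring) cproj. Suc k \<le> level x}"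
  let ?B = "{x :: ('n \<Rightarrow> 'p mod_ring) cproj. k \<le> level x} - ?A"
  let ?c = "ennreal (1 / card (clifford_group :: ('n \<Rightarrow> 'p mod_ring) op set set))"
  note card = invariant_prob_card_clifford[OF inv]
  interpret prob_space \<pi>
    using inv by (simp add: invariant_prob_def)
  have sets: "?A \<in> sets \<pi>" "{x. k \<le> level x} \<in> sets \<pi>" "?B \<in> sets \<pi>"
    using inv level_borel by (auto simp: invariant_prob_def intro: sets.Diff)
  have "emeasure \<pi> ?A + ?c * emeasure \<pi> ?B = (\<integral>\<^sup>+ x. indicator ?A x + ?c * indicator ?B x \<partial>\<pi>)"
    using sets by (simp add: nn_integral_add nn_integral_cmult)
  also have "\<dots> \<le> (\<integral>\<^sup>+ x. emeasure (ref_kernel j0 x) ?A \<partial>\<pi>)"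
  proof (rule nn_integral_mono)
    fix x
    consider "x \<in> ?A" | "x \<in> ?B" | "x \<notin> ?A" "x \<notin> ?B" by blast
    then show "indicator ?A x + ?c * indicator ?B x \<le> emeasure (ref_kernel j0 x) ?A"
    proof cases
      case 1
      then show ?thesis
        using kernel_level_absorbing[OF card, of "Suc k" x j0] by simp
    next
      case 2
      \<comment> \<open>Since \<open>Suc k\<close> is at most d^N, this level is below the top and a
        strict increase is available.\<close>
      then have "level x = k" by auto
      with 2 Suc.prems show ?thesis
        using kernel_level_increase[OF card, of x j0] by simp
    qed simp
  qed
  also have "\<dots> = emeasure \<pi> ?A"
    using inv level_borel[of "Suc k"] unfolding invariant_prob_def by metis
  finally have "emeasure \<pi> ?A + ?c * emeasure \<pi> ?B \<le> emeasure \<pi> ?A + 0" by simp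
  \<comment> \<open>Cancellation in \<open>ennreal\<close> is legitimate because the mass of
    \<open>?A\<close> is finite.\<close>
  then have "?c * emeasure \<pi> ?B = 0"
    using emeasure_finite[of ?A] by (simp add: ennreal_add_left_cancel_le)
  moreover have "?c \<noteq> 0"
    using card by simp
  ultimately have "emeasure \<pi> ?B = 0" by simp
  moreover have "emeasure \<pi> {x. k \<le> level x} = emeasure \<pi> ?A + emeasure \<pi> ?B"
    using sets by (subst plus_emeasure) (auto intro: arg_cong[of _ _ "emeasure \<pi>"])
  ultimately show ?case
    using Suc by simp
qed

theorem lemmaD4:
  fixes j0 :: "'n::finite"
    and \<pi>\<^sub>0 :: "('n \<Rightarrow> 'p::prime_card mod_ring) cproj measure"
  assumes "invariant_prob (ref_kernel j0) \<pi>\<^sub>0"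
  shows "emeasure \<pi>\<^sub>0 (stabilizer_states :: ('n \<Rightarrow> 'p mod_ring) cproj set) = 1"
  using invariant_prob_level[OF assms order_refl] unfolding stabilizer_states_eq level_def .

end
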